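(* Each of the two non-Abelian groups of order $27$ embeds in $B_9/\Gamma_2(P_9)$. That is, the following two groups embed in $B_9/\Gamma_2(P_9)$: (a) the semi-direct product $\mathbb{Z}_9\rtimes_{\theta}\mathbb{Z}_3$, where $\theta\colon\mathbb{Z}_3\to\operatorname{Aut}(\mathbb{Z}_9)$ is the homomorphism for which $\theta(1_3)$ is multiplication by $4$; (b) the Heisenberg group mod $3$, namely the group with presentation $\langle a,b,c\mid a^3=b^3=c^3=1,\ c=[a,b],\ [a,c]=[b,c]=1\rangle$.
   Context: For $n\in\mathbb{N}$, $B_n$ denotes the Artin braid group on $n$ strings, with generators $\sigma_1,\ldots,\sigma_{n-1}$ and relations $\sigma_i\sigma_j=\sigma_j\sigma_i$ for $|i-j|\geq 2$ and $\sigma_i\sigma_{i+1}\sigma_i=\sigma_{i+1}\sigma_i\sigma_{i+1}$ for $1\leq i\leq n-2$. The pure braid group $P_n$ is the kernel of the surjective homomorphism $\sigma\colon B_n\to S_n$ onto the symmetric group given by $\sigma(\sigma_i)=(i,i+1)$. $\Gamma_2(P_n)=[P_n,P_n]$ is the commutator subgroup of $P_n$, which is normal in $B_n$. $\mathbb{Z}_q$ denotes the cyclic group of order $q$, $1_q$ is the class of $1$ in $\mathbb{Z}_q$, and $[h,k]=hkh^{-1}k^{-1}$. A group $G$ embeds in a group $\Pi$ if there is an injective homomorphism $G\to\Pi$. *)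

theory Defs
  imports "HOL-Algebra.Sym_Groups" "HOL-Algebra.Elementary_Groups" "HOL-Algebra.Bij"
begin

section \<open>Groups given by generators and relations\<close>

text \<open>The letter \<open>(x, True)\<close> stands for the generator \<open>x\<close>, and \<open>(x, False)\<close> for its
  formal inverse.\<close>

type_synonym 'a group_word = "('a \<times> bool) list"

definition words :: "'a set \<Rightarrow> 'a group_word set" where
  "words X = lists (X \<times> UNIV)"

lemma words_simps [simp]:
  "[] \<in> words X"
  "(x, b) # w \<in> words X \<longleftrightarrow> x \<in> X \<and> w \<in> words X"
  "u @ v \<in> words X \<longleftrightarrow> u \<in> words X \<and> v \<in> words X"
  by (auto simp: words_def)

text \<open>The least congruence on the words over \<open>X\<close> that contains free cancellation and the
  relations \<open>u = v\<close> for \<open>(u, v) \<in> R\<close>.\<close>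

inductive_set word_rel ::
  "'a set \<Rightarrow> ('a group_word \<times> 'a group_word) set \<Rightarrow> ('a group_word \<times> 'a group_word) set"
  for X R where
  refl: "w \<in> words X \<Longrightarrow> (w, w) \<in> word_rel X R"
| sym: "(u, v) \<in> word_rel X R \<Longrightarrow> (v, u) \<in> word_rel X R"
| trans: "(u, v) \<in> word_rel X R \<Longrightarrow> (v, w) \<in> word_rel X R \<Longrightarrow> (u, w) \<in> word_rel X R"
| append: "(u, v) \<in> word_rel X R \<Longrightarrow> (u', v') \<in> word_rel X R \<Longrightarrow> (u @ u', v @ v') \<in> word_rel X R"
| cancel: "x \<in> X \<Longrightarrow> ([(x, b), (x, \<not> b)], []) \<in> word_rel X R"
| relation: "(u, v) \<in> R \<Longrightarrow> u \<in> words X \<Longrightarrow> v \<in> words X \<Longrightarrow> (u, v) \<in> word_rel X R"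

definition presented_group ::
  "'a set \<Rightarrow> ('a group_word \<times> 'a group_word) set \<Rightarrow> 'a group_word set monoid" where
  "presented_group X R =
    \<lparr>carrier = words X // word_rel X R,
     mult = (\<lambda>A B. \<Union>u\<in>A. \<Union>v\<in>B. word_rel X R `` {u @ v}),
     one = word_rel X R `` {[]}\<rparr>"

fun eval_word :: "('g, 'm) monoid_scheme \<Rightarrow> ('a \<Rightarrow> 'g) \<Rightarrow> 'a group_word \<Rightarrow> 'g" where
  "eval_word G f [] = \<one>\<^bsub>G\<^esub>"
| "eval_word G f ((x, b) # w) = (if b then f x else inv\<^bsub>G\<^esub> f x) \<otimes>\<^bsub>G\<^esub> eval_word G f w"

text \<open>The map out of a presented group determined by images \<open>f x\<close> of the generators; it does
  not depend on the chosen representative when the relations hold in \<open>G\<close>, see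
  \<open>presented_map_class\<close> and \<open>presented_map_hom\<close> below.\<close>

definition presented_map ::
  "('g, 'm) monoid_scheme \<Rightarrow> ('a \<Rightarrow> 'g) \<Rightarrow> 'a group_word set \<Rightarrow> 'g" where
  "presented_map G f A = eval_word G f (SOME w. w \<in> A)"

lemma word_rel_words: "(u, v) \<in> word_rel X R \<Longrightarrow> u \<in> words X \<and> v \<in> words X"
  by (induction rule: word_rel.induct) auto

lemma equiv_word_rel: "equiv (words X) (word_rel X R)"
proof (rule equivI)
  show "word_rel X R \<subseteq> words X \<times> words X"
    using word_rel_words by fast
  show "refl_on (words X) (word_rel X R)"
    by (auto simp: refl_on_def intro: word_rel.refl)
  show "sym (word_rel X R)"
    by (auto simp: sym_def intro: word_rel.sym)
  show "trans (word_rel X R)"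
    by (auto simp: trans_def intro: word_rel.trans)
qed

lemma mult_presented_group:
  assumes "u \<in> words X" "v \<in> words X"
  shows "word_rel X R `` {u} \<otimes>\<^bsub>presented_group X R\<^esub> word_rel X R `` {v} = word_rel X R `` {u @ v}"
proof -
  have "congruent2 (word_rel X R) (word_rel X R) (\<lambda>u v. word_rel X R `` {u @ v})"
    by (auto simp: congruent2_def intro!: equiv_class_eq[OF equiv_word_rel] word_rel.append)
  from UN_equiv_class2[OF equiv_word_rel equiv_word_rel this assms] show ?thesis
    by (simp add: presented_group_def)
qed

lemma class_in_presented_group:
  "w \<in> words X \<Longrightarrow> word_rel X R `` {w} \<in> carrier (presented_group X R)"
  by (simp add: presented_group_def quotientI)

lemma presented_group_cases:
  assumes "A \<in> carrier (presented_group X R)"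
  obtains w where "w \<in> words X" "A = word_rel X R `` {w}"
  using assms by (auto simp: presented_group_def elim!: quotientE)

lemma one_presented_group: "\<one>\<^bsub>presented_group X R\<^esub> = word_rel X R `` {[]}"
  by (simp add: presented_group_def)

definition inverse_word :: "'a group_word \<Rightarrow> 'a group_word" where
  "inverse_word w = rev (map (\<lambda>(x, b). (x, \<not> b)) w)"

lemma inverse_word_words: "w \<in> words X \<Longrightarrow> inverse_word w \<in> words X"
  by (auto simp: inverse_word_def words_def)

lemma inverse_word_cancel:
  "w \<in> words X \<Longrightarrow> (inverse_word w @ w, []) \<in> word_rel X R"
proof (induction w)
  case Nil
  then show ?case by (auto simp: inverse_word_def intro: word_rel.refl)
next
  case (Cons y w)
  obtain x b where y: "y = (x, b)" by fastforce
  have x: "x \<in> X" and w: "w \<in> words X" using Cons.prems y by auto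
  have "([(x, \<not> b), (x, b)] @ w, [] @ w) \<in> word_rel X R"
    using word_rel.append[OF word_rel.cancel[OF x, of "\<not> b"] word_rel.refl[OF w]] by simp
  from word_rel.append[OF word_rel.refl[OF inverse_word_words[OF w]] this]
  have "(inverse_word (y # w) @ y # w, inverse_word w @ w) \<in> word_rel X R"
    by (simp add: inverse_word_def y)
  then show ?case using Cons.IH[OF w] word_rel.trans by blast
qed

lemma group_presented_group: "group (presented_group X R)"
proof (rule groupI)
  fix A B assume "A \<in> carrier (presented_group X R)" "B \<in> carrier (presented_group X R)"
  then show "A \<otimes>\<^bsub>presented_group X R\<^esub> B \<in> carrier (presented_group X R)"
    by (auto elim!: presented_group_cases simp: mult_presented_group intro!: class_in_presented_group)
next
  show "\<one>\<^bsub>presented_group X R\<^esub> \<in> carrier (presented_group X R)"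
    by (auto simp: one_presented_group intro!: class_in_presented_group)
next
  fix A B C assume "A \<in> carrier (presented_group X R)" "B \<in> carrier (presented_group X R)"
    "C \<in> carrier (presented_group X R)"
  then show "A \<otimes>\<^bsub>presented_group X R\<^esub> B \<otimes>\<^bsub>presented_group X R\<^esub> C =
      A \<otimes>\<^bsub>presented_group X R\<^esub> (B \<otimes>\<^bsub>presented_group X R\<^esub> C)"
    by (auto elim!: presented_group_cases simp: mult_presented_group)
next
  fix A assume "A \<in> carrier (presented_group X R)"
  then show "\<one>\<^bsub>presented_group X R\<^esub> \<otimes>\<^bsub>presented_group X R\<^esub> A = A"
    by (auto elim!: presented_group_cases simp: one_presented_group mult_presented_group)
next
  fix A assume "A \<in> carrier (presented_group X R)"
  then obtain w where w: "w \<in> words X" "A = word_rel X R `` {w}"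
    by (rule presented_group_cases)
  have "word_rel X R `` {inverse_word w} \<otimes>\<^bsub>presented_group X R\<^esub> A = \<one>\<^bsub>presented_group X R\<^esub>"
    using w equiv_class_eq[OF equiv_word_rel inverse_word_cancel[OF w(1)]]
    by (simp add: mult_presented_group inverse_word_words one_presented_group)
  then show "\<exists>B\<in>carrier (presented_group X R). B \<otimes>\<^bsub>presented_group X R\<^esub> A = \<one>\<^bsub>presented_group X R\<^esub>"
    using class_in_presented_group[OF inverse_word_words[OF w(1)]] by blast
qed

context group
begin

lemma eval_word_closed: "w \<in> words X \<Longrightarrow> f ` X \<subseteq> carrier G \<Longrightarrow> eval_word G f w \<in> carrier G"
  by (induction w) (auto simp: image_subset_iff)

lemma eval_word_append:
  "u \<in> words X \<Longrightarrow> v \<in> words X \<Longrightarrow> f ` X \<subseteq> carrier G \<Longrightarrow>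
    eval_word G f (u @ v) = eval_word G f u \<otimes> eval_word G f v"
proof (induction u)
  case Nil
  then show ?case using eval_word_closed[of v X f] by simp
next
  case (Cons y u)
  then show ?case
    using eval_word_closed[of u X f] eval_word_closed[of v X f]
    by (cases y) (auto simp: m_assoc image_subset_iff)
qed

lemma eval_word_rel:
  assumes "(u, v) \<in> word_rel X R" and f: "f ` X \<subseteq> carrier G"
    and R: "\<And>u v. (u, v) \<in> R \<Longrightarrow> u \<in> words X \<Longrightarrow> v \<in> words X \<Longrightarrow> eval_word G f u = eval_word G f v"
  shows "eval_word G f u = eval_word G f v"
  using assms(1)
proof (induction rule: word_rel.induct)
  case (append u v u' v')
  then show ?case using eval_word_append[OF _ _ f] word_rel_words by metis
next
  case (cancel x b)
  then show ?case using f by (cases b) (auto simp: image_subset_iff)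
qed (auto intro: R)

lemma presented_map_class:
  assumes w: "w \<in> words X" and f: "f ` X \<subseteq> carrier G"
    and R: "\<And>u v. (u, v) \<in> R \<Longrightarrow> u \<in> words X \<Longrightarrow> v \<in> words X \<Longrightarrow> eval_word G f u = eval_word G f v"
  shows "presented_map G f (word_rel X R `` {w}) = eval_word G f w"
proof -
  have "w \<in> word_rel X R `` {w}" using w by (auto intro: word_rel.refl)
  then have "(SOME v. v \<in> word_rel X R `` {w}) \<in> word_rel X R `` {w}" by (rule someI)
  then have "(w, SOME v. v \<in> word_rel X R `` {w}) \<in> word_rel X R" by simp
  from eval_word_rel[OF this f R] show ?thesis by (simp add: presented_map_def)
qed

lemma presented_map_hom:
  assumes f: "f ` X \<subseteq> carrier G"
    and R: "\<And>u v. (u, v) \<in> R \<Longrightarrow> u \<in> words X \<Longrightarrow> v \<in> words X \<Longrightarrow> eval_word G f u = eval_word G f v"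
  shows "presented_map G f \<in> hom (presented_group X R) G"
proof (rule homI)
  fix A assume "A \<in> carrier (presented_group X R)"
  then show "presented_map G f A \<in> carrier G"
    by (rule presented_group_cases) (simp add: presented_map_class[OF _ f R] eval_word_closed[OF _ f])
next
  fix A B assume "A \<in> carrier (presented_group X R)" "B \<in> carrier (presented_group X R)"
  then obtain u v where uv: "u \<in> words X" "v \<in> words X"
    and AB: "A = word_rel X R `` {u}" "B = word_rel X R `` {v}"
    by (blast elim: presented_group_cases)
  have "u @ v \<in> words X" using uv by simp
  with uv show "presented_map G f (A \<otimes>\<^bsub>presented_group X R\<^esub> B) = presented_map G f A \<otimes> presented_map G f B"
    by (simp only: AB mult_presented_group presented_map_class[OF _ f R] eval_word_append[OF _ _ f])
qed

end

section \<open>Braid groups and pure braid groups\<close>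

definition braid_relations :: "nat \<Rightarrow> (nat group_word \<times> nat group_word) set" where
  "braid_relations n =
    {([(i, True), (j, True)], [(j, True), (i, True)]) | i j.
       i \<in> {1..<n} \<and> j \<in> {1..<n} \<and> \<bar>int i - int j\<bar> \<ge> 2} \<union>
    {([(i, True), (i + 1, True), (i, True)], [(i + 1, True), (i, True), (i + 1, True)]) | i.
       1 \<le> i \<and> i + 2 \<le> n}"

definition braid_group :: "nat \<Rightarrow> nat group_word set monoid" where
  "braid_group n = presented_group {1..<n} (braid_relations n)"

definition braid_perm :: "nat \<Rightarrow> nat group_word set \<Rightarrow> nat \<Rightarrow> nat" where
  "braid_perm n = presented_map (sym_group n) (\<lambda>i. transpose i (i + 1))"

definition pure_braid_group :: "nat \<Rightarrow> nat group_word set set" where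
  "pure_braid_group n = kernel (braid_group n) (sym_group n) (braid_perm n)"

definition braid_quotient :: "nat \<Rightarrow> nat group_word set set monoid" where
  "braid_quotient n = braid_group n Mod derived (braid_group n) (pure_braid_group n)"

lemma transpose_in_sym_group:
  "(\<lambda>i. transpose i (i + 1)) ` {1..<n} \<subseteq> carrier (sym_group n)"
  by (auto simp: sym_group_carrier intro!: permutes_swap_id)

lemma braid_relations_sym_group:
  assumes "(u, v) \<in> braid_relations n"
  shows "eval_word (sym_group n) (\<lambda>i. transpose i (i + 1)) u =
    eval_word (sym_group n) (\<lambda>i. transpose i (i + 1)) v"
  using assms
  by (auto simp: braid_relations_def sym_group_mult sym_group_one fun_eq_iff transpose_def)

lemma braid_perm_hom: "braid_perm n \<in> hom (braid_group n) (sym_group n)"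
  unfolding braid_perm_def braid_group_def
  by (intro group.presented_map_hom sym_group_is_group transpose_in_sym_group braid_relations_sym_group)

lemma braid_perm_generator:
  assumes "i \<in> {1..<n}"
  shows "braid_perm n (word_rel {1..<n} (braid_relations n) `` {[(i, True)]}) = transpose i (i + 1)"
proof -
  have "[(i, True)] \<in> words {1..<n}" using assms by simp
  then have "braid_perm n (word_rel {1..<n} (braid_relations n) `` {[(i, True)]}) =
      eval_word (sym_group n) (\<lambda>i. transpose i (i + 1)) [(i, True)]"
    unfolding braid_perm_def
    by (rule group.presented_map_class[OF sym_group_is_group _ transpose_in_sym_group
          braid_relations_sym_group])
  then show ?thesis by (simp add: sym_group_mult sym_group_one)
qed

section \<open>The two groups of order 27\<close>

definition semidirect_product ::
  "('a, 'm) monoid_scheme \<Rightarrow> ('b, 'n) monoid_scheme \<Rightarrow> ('b \<Rightarrow> 'a \<Rightarrow> 'a) \<Rightarrow> ('a \<times> 'b) monoid" where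
  "semidirect_product N H \<theta> =
    \<lparr>carrier = carrier N \<times> carrier H,
     mult = (\<lambda>(x, h) (y, k). (x \<otimes>\<^bsub>N\<^esub> \<theta> h y, h \<otimes>\<^bsub>H\<^esub> k)),
     one = (\<one>\<^bsub>N\<^esub>, \<one>\<^bsub>H\<^esub>)\<rparr>"

text \<open>An action as required in the theorem exists.\<close>

lemma ex_action_Z3_Z9:
  "\<exists>\<theta> \<in> hom (integer_mod_group 3) (AutoGroup (integer_mod_group 9)).
     \<forall>x \<in> carrier (integer_mod_group 9). \<theta> 1 x = 4 * x mod 9"
proof -
  define S :: "int set" where "S = {0..<9}"
  define \<theta> :: "int \<Rightarrow> int \<Rightarrow> int" where "\<theta> k = (\<lambda>x\<in>S. 4 ^ nat k * x mod 9)" for k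
  have car9: "carrier (integer_mod_group 9) = S" by (simp add: S_def carrier_integer_mod_group)
  have pow: "(4 ^ nat ((h + k) mod 3) :: int) mod 9 = 4 ^ nat h * 4 ^ nat k mod 9"
    if "h \<in> {0..<3}" "k \<in> {0..<3}" for h k :: int
  proof -
    have "h \<in> {0, 1, 2}" "k \<in> {0, 1, 2}" using that by auto
    then show ?thesis by (auto simp: nat_mod_distrib)
  qed
  have closed: "\<theta> k x \<in> S" if "x \<in> S" for k x using that by (auto simp: \<theta>_def S_def)
  have comp: "\<theta> ((h + k) mod 3) x = \<theta> h (\<theta> k x)"
    if "h \<in> {0..<3}" "k \<in> {0..<3}" "x \<in> S" for h k x
  proof -
    have "4 ^ nat ((h + k) mod 3) * x mod 9 = (4 ^ nat h * 4 ^ nat k) * x mod 9"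
      using pow[OF that(1,2)] by (metis mod_mult_left_eq)
    also have "\<dots> = 4 ^ nat h * (4 ^ nat k * x mod 9) mod 9"
      by (simp add: mod_mult_right_eq mult.assoc)
    finally have "4 ^ nat ((h + k) mod 3) * x mod 9 = 4 ^ nat h * (4 ^ nat k * x mod 9) mod 9" .
    moreover have "4 ^ nat k * x mod 9 \<in> S" by (simp add: S_def)
    ultimately show ?thesis using that(3) by (simp only: \<theta>_def restrict_apply')
  qed
  have id: "\<theta> 0 x = x" if "x \<in> S" for x using that by (auto simp: \<theta>_def S_def)
  have auto: "\<theta> k \<in> auto (integer_mod_group 9)" if k: "k \<in> {0..<3}" for k
  proof -
    have k': "(- k) mod 3 \<in> {0..<3}" by auto
    have inv: "\<theta> ((- k) mod 3) (\<theta> k x) = x" "\<theta> k (\<theta> ((- k) mod 3) x) = x" if "x \<in> S" for x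
      using comp[OF k' k that] comp[OF k k' that] id[OF that]
      by (simp_all add: mod_add_left_eq mod_add_right_eq)
    have "bij_betw (\<theta> k) S S"
      by (rule bij_betw_byWitness[where f' = "\<theta> ((- k) mod 3)"]) (use inv closed in auto)
    moreover have "\<theta> k \<in> extensional S" by (simp add: \<theta>_def)
    moreover have "\<theta> k \<in> hom (integer_mod_group 9) (integer_mod_group 9)"
    proof (rule homI; simp only: car9)
      fix x y assume xy: "x \<in> S" "y \<in> S"
      then have "(x + y) mod 9 \<in> S" by (simp add: S_def)
      with xy show "\<theta> k (x \<otimes>\<^bsub>integer_mod_group 9\<^esub> y) = \<theta> k x \<otimes>\<^bsub>integer_mod_group 9\<^esub> \<theta> k y"
        by (simp add: \<theta>_def mod_mult_right_eq mod_add_eq distrib_left)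
    qed (rule closed)
    ultimately show ?thesis by (simp add: auto_def Bij_def car9)
  qed
  have "\<theta> \<in> hom (integer_mod_group 3) (AutoGroup (integer_mod_group 9))"
  proof (rule homI)
    fix k :: int assume "k \<in> carrier (integer_mod_group 3)"
    then show "\<theta> k \<in> carrier (AutoGroup (integer_mod_group 9))"
      using auto by (simp add: AutoGroup_def carrier_integer_mod_group)
  next
    fix h k :: int assume "h \<in> carrier (integer_mod_group 3)" "k \<in> carrier (integer_mod_group 3)"
    then have hk: "h \<in> {0..<3}" "k \<in> {0..<3}" by (auto simp: carrier_integer_mod_group)
    have "\<theta> ((h + k) mod 3) = compose S (\<theta> h) (\<theta> k)"
    proof
      fix x show "\<theta> ((h + k) mod 3) x = compose S (\<theta> h) (\<theta> k) x"
      proof (cases "x \<in> S")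
        case True
        then show ?thesis by (simp only: comp[OF hk True] compose_eq)
      next
        case False
        then show ?thesis by (simp only: compose_def \<theta>_def restrict_def if_False)
      qed
    qed
    moreover have "\<theta> h \<in> Bij S" "\<theta> k \<in> Bij S"
      using auto[OF hk(1)] auto[OF hk(2)] by (auto simp: auto_def car9)
    ultimately show "\<theta> (h \<otimes>\<^bsub>integer_mod_group 3\<^esub> k) = \<theta> h \<otimes>\<^bsub>AutoGroup (integer_mod_group 9)\<^esub> \<theta> k"
      by (simp add: AutoGroup_def BijGroup_def car9)
  qed
  moreover have "\<forall>x \<in> carrier (integer_mod_group 9). \<theta> 1 x = 4 * x mod 9"
    by (simp add: car9 \<theta>_def)
  ultimately show ?thesis by blast
qed

datatype heisenberg_gen = a_gen | b_gen | c_gen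

definition heisenberg_relations :: "(heisenberg_gen group_word \<times> heisenberg_gen group_word) set" where
  "heisenberg_relations =
    (let commutator = (\<lambda>x y. [(x, True), (y, True), (x, False), (y, False)]) in
     {(replicate 3 (a_gen, True), []),
      (replicate 3 (b_gen, True), []),
      (replicate 3 (c_gen, True), []),
      ([(c_gen, True)], commutator a_gen b_gen),
      (commutator a_gen c_gen, []),
      (commutator b_gen c_gen, [])})"

definition heisenberg_group_mod_3 :: "heisenberg_gen group_word set monoid" where
  "heisenberg_group_mod_3 = presented_group UNIV heisenberg_relations"

section \<open>Embeddings\<close>

definition embeds_in :: "('a, 'm) monoid_scheme \<Rightarrow> ('b, 'n) monoid_scheme \<Rightarrow> bool" where
  "embeds_in G H \<longleftrightarrow> (\<exists>f \<in> hom G H. inj_on f (carrier G))"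

end

(* A braid word is pure iff every strand returns to its position, and modulo [P_n, P_n] a pure
   braid is determined by its pairwise linking numbers. Indeed, modulo [P_n, P_n] conjugation by the
   generators permutes the standard pure generators A_ij, since sigma_k^2 acts trivially; by the
   Coxeter presentation of S_n they therefore generate the pure part, and linking numbers show
   that the resulting abelian group is free on them. Consequently a relation between words holds in
   B_n / [P_n, P_n] once permutations and linking numbers agree, which is a finite computation.

   Both non-abelian groups of order 27 are generated by x, y with z = [x, y] central and
   non-trivial, y^3 = 1 and x^3 = z^e, where e = 0 for the Heisenberg group and e = 1 for
   Z_9 : Z_3. These relations and z \<noteq> 1 already decide when two words x^i y^j z^k coincide, so any
   elements of the braid quotient satisfying them span an embedded copy of the group. *)

theory Submission
  imports Defs "HOL-Algebra.Group_Action" "HOL-Algebra.Multiplicative_Group"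
    "HOL-Algebra.FiniteProduct" "HOL-Computational_Algebra.Primes"
begin

section \<open>The center of a finite p-group\<close>

text \<open>Both groups act faithfully on nine points, whence the nine strands. Lifting two
  generating permutations to braids satisfies the relations only up to pure braids, whose linking
  numbers are the obstruction. The freedom left is the sign of each crossing in a reduced word, and
  suitable signs make all linking numbers of the relators vanish at once. That every non-abelian
  group of order 27 contains a triple x, y, z as described rests on its center having order 3 and
  containing all commutators. Collecting (g h)^3 produces three copies of one central commutator, so
  cubing is a homomorphism into the center, and y is found in its kernel. For the Heisenberg group,
  given by a presentation only, the difficulty is that c might collapse. The braid quotient itself
  rules this out: it satisfies the relations with a non-trivial image of c.\<close>

definition center :: "('a, 'm) monoid_scheme \<Rightarrow> 'a set" where
  "center G = {z \<in> carrier G. \<forall>g \<in> carrier G. g \<otimes>\<^bsub>G\<^esub> z = z \<otimes>\<^bsub>G\<^esub> g}"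

context group
begin

lemma center_mem: "z \<in> center G \<Longrightarrow> z \<in> carrier G"
  by (simp add: center_def)

lemma center_commute: "z \<in> center G \<Longrightarrow> g \<in> carrier G \<Longrightarrow> g \<otimes> z = z \<otimes> g"
  by (simp add: center_def)

definition centralizer :: "'a \<Rightarrow> 'a set" where
  "centralizer a = {g \<in> carrier G. g \<otimes> a = a \<otimes> g}"

lemma commute_inv:
  assumes "g \<in> carrier G" "a \<in> carrier G" "g \<otimes> a = a \<otimes> g"
  shows "inv g \<otimes> a = a \<otimes> inv g"
proof -
  have "inv g \<otimes> a = inv g \<otimes> (a \<otimes> g) \<otimes> inv g" using assms by (simp add: m_assoc)
  also have "\<dots> = inv g \<otimes> (g \<otimes> a) \<otimes> inv g" using assms by simp
  also have "inv g \<otimes> (g \<otimes> a) = a" using assms(1,2) by (simp flip: m_assoc)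
  finally show ?thesis .
qed

lemma subgroup_centralizer:
  assumes "a \<in> carrier G"
  shows "subgroup (centralizer a) G"
proof
  fix g h assume "g \<in> centralizer a" "h \<in> centralizer a"
  then have "g \<in> carrier G" "h \<in> carrier G" "g \<otimes> a = a \<otimes> g" "h \<otimes> a = a \<otimes> h"
    by (auto simp: centralizer_def)
  then have "g \<otimes> h \<otimes> a = a \<otimes> (g \<otimes> h)" using assms by (metis m_assoc)
  then show "g \<otimes> h \<in> centralizer a"
    using \<open>g \<in> carrier G\<close> \<open>h \<in> carrier G\<close> by (simp add: centralizer_def)
qed (use assms in \<open>auto simp: centralizer_def commute_inv\<close>)

lemma subgroup_center: "subgroup (center G) G"
proof -
  have "center G = (\<Inter>a \<in> carrier G. centralizer a)"
    by (auto simp: center_def centralizer_def)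
  moreover have "subgroup (\<Inter>(centralizer ` carrier G)) G"
    by (rule subgroups_Inter) (use subgroup_centralizer in auto)
  ultimately show ?thesis by simp
qed

lemma normal_center: "center G \<lhd> G"
  unfolding normal_inv_iff
proof (intro conjI ballI subgroup_center)
  fix x h assume "x \<in> carrier G" "h \<in> center G"
  then show "x \<otimes> h \<otimes> inv x \<in> center G"
    using center_commute[of h x] center_mem[of h] by (simp add: m_assoc)
qed

text \<open>Class equation: the conjugacy classes of size 1 are exactly those of central elements,
  and by the orbit-stabilizer theorem every other class has size a positive power of p.\<close>

lemma card_center_dvd:
  assumes "order G = p ^ m" "prime p" "m > 0"
  shows "p dvd card (center G)"
proof -
  define conj where "conj = (\<lambda>g. \<lambda>h \<in> carrier G. g \<otimes> h \<otimes> inv g)"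
  interpret act: group_action G "carrier G" conj
    unfolding conj_def by (rule action_by_conjugation)
  have fin: "finite (carrier G)"
    using assms(1) order_gt_0_iff_finite prime_gt_0_nat[OF assms(2)] by simp
  have orbit: "orbit G conj a = {g \<otimes> a \<otimes> inv g | g. g \<in> carrier G}" if "a \<in> carrier G" for a
    using that by (auto simp: orbit_def conj_def)
  have self: "a \<in> orbit G conj a" if "a \<in> carrier G" for a
    using act.orbit_refl[OF that] .
  have fin_orb: "finite (orbit G conj a)" if "a \<in> carrier G" for a
    using orbit[OF that] fin by simp
  have in_center: "a \<in> center G \<longleftrightarrow> card (orbit G conj a) = 1" if a: "a \<in> carrier G" for a
  proof
    assume "a \<in> center G"
    then have "g \<otimes> a \<otimes> inv g = a" if "g \<in> carrier G" for g
      using center_commute[OF _ that] a that by (simp add: m_assoc)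
    then have "orbit G conj a \<subseteq> {a}" unfolding orbit[OF a] by blast
    with self[OF a] have "orbit G conj a = {a}" by blast
    then show "card (orbit G conj a) = 1" by simp
  next
    assume "card (orbit G conj a) = 1"
    then have "orbit G conj a = {a}" using self[OF a] by (auto simp: card_1_singleton_iff)
    then have *: "g \<otimes> a \<otimes> inv g = a" if "g \<in> carrier G" for g using orbit[OF a] that by blast
    have "g \<otimes> a = a \<otimes> g" if "g \<in> carrier G" for g
      using *[OF that] a that inv_solve_right[of a "g \<otimes> a" g] by simp
    then show "a \<in> center G" using a by (simp add: center_def)
  qed
  have orb_dvd: "p dvd card (orbit G conj a)" if a: "a \<in> carrier G" "a \<notin> center G" for a
  proof -
    have "card (orbit G conj a) dvd p ^ m"
      using act.orbit_stabilizer_theorem[OF a(1)] assms(1) by (metis dvd_triv_left)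
    moreover have "card (orbit G conj a) \<noteq> 1" using in_center a by simp
    ultimately show ?thesis
      using assms(2) by (auto simp: divides_primepow_nat intro!: dvd_power intro: gr0I)
  qed
  define S where "S = orbits G (carrier G) conj"
  have finS: "finite S" using fin unfolding S_def orbits_def by simp
  have S: "\<exists>a \<in> carrier G. X = orbit G conj a" if "X \<in> S" for X
    using that by (auto simp: S_def orbits_def)
  define T where "T = {X \<in> S. card X = 1}"
  have "order G = card (\<Union>S)" unfolding S_def act.orbits_coverture by (simp add: order_def)
  also have "\<dots> = (\<Sum>X\<in>S. card X)"
    using act.disjoint_union S fin_orb
    by (intro card_Union_disjoint) (auto simp: pairwise_def disjnt_def S_def orbits_def)
  also have "\<dots> = (\<Sum>X\<in>S - T. card X) + (\<Sum>X\<in>T. card X)"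
    using finS by (intro sum.subset_diff) (auto simp: T_def)
  also have "(\<Sum>X\<in>T. card X) = card (center G)"
  proof -
    have "T = (\<lambda>a. {a}) ` center G"
    proof (rule equalityI; rule subsetI)
      fix X assume "X \<in> T"
      then obtain a where a: "a \<in> carrier G" "X = orbit G conj a" "card X = 1"
        using S by (auto simp: T_def)
      then have "X = {a}" using self[of a] by (auto simp: card_1_singleton_iff)
      then show "X \<in> (\<lambda>a. {a}) ` center G" using a in_center by auto
    next
      fix X assume "X \<in> (\<lambda>a. {a}) ` center G"
      then obtain a where a: "a \<in> center G" "X = {a}" by auto
      then have "card (orbit G conj a) = 1" "a \<in> carrier G" using in_center center_mem by auto
      then have "orbit G conj a = X" using self[of a] a by (auto simp: card_1_singleton_iff)
      then show "X \<in> T" using \<open>card _ = 1\<close> \<open>a \<in> carrier G\<close> by (auto simp: T_def S_def orbits_def)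
    qed
    then have "card T = card (center G)" by (simp add: card_image)
    moreover have "(\<Sum>X\<in>T. card X) = card T" by (simp add: T_def)
    ultimately show ?thesis by simp
  qed
  finally have "p ^ m = (\<Sum>X\<in>S - T. card X) + card (center G)" using assms by simp
  moreover have "p dvd (\<Sum>X\<in>S - T. card X)"
  proof (rule dvd_sum)
    fix X assume X: "X \<in> S - T"
    then obtain a where "a \<in> carrier G" "X = orbit G conj a" using S by blast
    then show "p dvd card X" using X orb_dvd in_center by (auto simp: T_def)
  qed
  moreover have "p dvd p ^ m" using assms(3) by (simp add: dvd_power)
  ultimately show ?thesis by (metis dvd_add_right_iff)
qed

lemma card_subgroup_dvd:
  "subgroup H G \<Longrightarrow> card H dvd order G"
  using lagrange by (metis dvd_triv_right)

text \<open>Both cardinalities are powers of p, so a strict inclusion raises the exponent by at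
  least one.\<close>

lemma card_subgroups_less:
  assumes "order G = p ^ m" "prime p" "subgroup H G" "subgroup K G" "H \<subset> K"
  shows "p * card H \<le> card K"
proof -
  have fin: "finite (carrier G)"
    using assms(1) order_gt_0_iff_finite prime_gt_0_nat[OF assms(2)] by simp
  interpret K: group "G\<lparr>carrier := K\<rparr>" using assms(4) by (rule subgroup_imp_group)
  have "subgroup H (G\<lparr>carrier := K\<rparr>)" using assms by (intro subgroup_incl) auto
  then have "card H dvd card K" using K.card_subgroup_dvd by (simp add: order_def)
  moreover have "card K dvd p ^ m" "card H dvd p ^ m"
    using card_subgroup_dvd[OF assms(4)] card_subgroup_dvd[OF assms(3)] assms(1) by simp_all
  then obtain i j where ij: "card K = p ^ i" "card H = p ^ j"
    using divides_primepow_nat[OF assms(2)] by blast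
  moreover have "card H < card K"
    using assms(5) finite_subset[OF subgroup.subset[OF assms(4)] fin] by (rule psubset_card_mono[rotated])
  ultimately have "j < i" using prime_gt_1_nat[OF assms(2)] by simp
  then have "p ^ Suc j \<le> p ^ i" using assms(2) by (intro power_increasing) (use prime_ge_1_nat in auto)
  then show ?thesis using ij by simp
qed

lemma centralizer_strict:
  assumes "a \<in> carrier G" "a \<notin> center G"
  shows "center G \<subset> centralizer a" "centralizer a \<subset> carrier G"
  using assms by (auto simp: center_def centralizer_def)

text \<open>A non-central element would give a chain center < centralizer < G with two strict steps.
  Each step costs a factor p and the center contributes another one, so p^3 would be at most
  p^2.\<close>

lemma order_square_of_prime_commute:
  assumes "order G = p ^ 2" "prime p" "a \<in> carrier G" "b \<in> carrier G"
  shows "a \<otimes> b = b \<otimes> a"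
proof (rule ccontr)
  assume "a \<otimes> b \<noteq> b \<otimes> a"
  then have a: "a \<notin> center G" using assms by (metis center_commute)
  have "p * card (center G) \<le> card (centralizer a)"
    using assms centralizer_strict[OF assms(3) a]
    by (intro card_subgroups_less[of p 2] subgroup_center subgroup_centralizer)
  moreover have "p * card (centralizer a) \<le> card (carrier G)"
    using assms centralizer_strict[OF assms(3) a]
    by (intro card_subgroups_less[of p 2] subgroup_self subgroup_centralizer)
  moreover have "p dvd card (center G)" using assms(1,2) by (intro card_center_dvd[of p 2]) auto
  moreover have "card (center G) > 0"
    using lagrange[OF subgroup_center] assms(1) prime_gt_0_nat[OF assms(2)]
    by (metis gr0I mult_0_right zero_less_power)
  ultimately have "p * (p * p) \<le> p ^ 2"
    using assms(1) by (metis dvd_imp_le le_trans mult_le_mono2 order_def)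
  then show False using prime_gt_1_nat[OF assms(2)] by (simp add: power2_eq_square)
qed

text \<open>The chain center < centralizer < G gives 9 * |center| <= 27, and 3 divides |center|. The
  quotient by the center then has order 9 and is abelian, which puts all commutators into the
  center.\<close>

lemma nonabelian_order_27:
  assumes "order G = 27" "a \<in> carrier G" "b \<in> carrier G" "a \<otimes> b \<noteq> b \<otimes> a"
  shows "card (center G) = 3" "\<And>g h. g \<in> carrier G \<Longrightarrow> h \<in> carrier G \<Longrightarrow> g \<otimes> h \<otimes> inv g \<otimes> inv h \<in> center G"
proof -
  have p: "order G = 3 ^ 3" "prime (3 :: nat)" using assms(1) by simp_all
  have a: "a \<notin> center G" using assms by (metis center_commute)
  have "3 * card (center G) \<le> card (centralizer a)"
    using p centralizer_strict[OF assms(2) a] assms(2)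
    by (intro card_subgroups_less[of 3 3] subgroup_center subgroup_centralizer)
  moreover have "3 * card (centralizer a) \<le> card (carrier G)"
    using p centralizer_strict[OF assms(2) a] assms(2)
    by (intro card_subgroups_less[of 3 3] subgroup_self subgroup_centralizer)
  ultimately have "card (center G) \<le> 3" using assms(1) by (simp add: order_def)
  moreover have "3 dvd card (center G)" by (rule card_center_dvd[OF p]) simp
  moreover have "card (center G) \<noteq> 0"
    using lagrange[OF subgroup_center] assms(1) by (metis mult_0_right zero_neq_numeral)
  ultimately show Z: "card (center G) = 3" by (auto dest: dvd_imp_le)
  interpret Z: normal "center G" G by (rule normal_center)
  interpret Q: group "G Mod center G" by (rule Z.factorgroup_is_group)
  have "order (G Mod center G) = 3 ^ 2"
    using lagrange[OF subgroup_center] Z assms(1) by (simp add: FactGroup_def order_def)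
  from Q.order_square_of_prime_commute[OF this p(2)]
  have comm: "X \<otimes>\<^bsub>G Mod center G\<^esub> Y = Y \<otimes>\<^bsub>G Mod center G\<^esub> X"
    if "X \<in> carrier (G Mod center G)" "Y \<in> carrier (G Mod center G)" for X Y using that .
  fix g h assume gh: "g \<in> carrier G" "h \<in> carrier G"
  have "center G #> (g \<otimes> h) = center G #> (h \<otimes> g)"
    using comm[of "center G #> g" "center G #> h"] gh Z.rcos_sum
    by (auto simp: FactGroup_def RCOSETS_def)
  then have "g \<otimes> h \<in> center G #> (h \<otimes> g)"
    using rcos_self[OF _ subgroup_center, of "g \<otimes> h"] gh by simp
  then obtain z where z: "z \<in> center G" "g \<otimes> h = z \<otimes> (h \<otimes> g)" by (auto simp: r_coset_def)
  then have "g \<otimes> h \<otimes> inv g \<otimes> inv h = z"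
    using gh center_mem[OF z(1)] by (simp add: m_assoc)
  then show "g \<otimes> h \<otimes> inv g \<otimes> inv h \<in> center G" using z(1) by simp
qed

end

section \<open>The non-abelian groups of order 27\<close>

text \<open>No finiteness is assumed and x, y need not generate, so that the infinite braid quotient
  can be an instance beside the groups to be embedded. Writing z = [x, y] as x y = z y x keeps
  inverses out of the normal form calculations.\<close>

locale extraspecial_triple = group G for G (structure) +
  fixes x y z :: 'a and e :: nat
  assumes x_closed [simp]: "x \<in> carrier G" and y_closed [simp]: "y \<in> carrier G"
    and z_closed [simp]: "z \<in> carrier G"
    and xy: "x \<otimes> y = z \<otimes> y \<otimes> x"
    and zx: "z \<otimes> x = x \<otimes> z" and zy: "z \<otimes> y = y \<otimes> z"
    and y_cube: "y [^] (3 :: nat) = \<one>" and x_cube: "x [^] (3 :: nat) = z [^] e"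
    and z_neq_one: "z \<noteq> \<one>"
begin

lemma z_pow_commute:
  "z [^] (k :: nat) \<otimes> x [^] (i :: nat) = x [^] i \<otimes> z [^] k"
  "z [^] (k :: nat) \<otimes> y [^] (j :: nat) = y [^] j \<otimes> z [^] k"
  using group_commutes_pow zx zy by (metis nat_pow_closed x_closed y_closed z_closed)+

lemma z_pow_left_commute:
  assumes "g \<in> carrier G"
  shows "z [^] (k :: nat) \<otimes> (x [^] (i :: nat) \<otimes> g) = x [^] i \<otimes> (z [^] k \<otimes> g)"
    "z [^] (k :: nat) \<otimes> (y [^] (j :: nat) \<otimes> g) = y [^] j \<otimes> (z [^] k \<otimes> g)"
  using assms z_pow_commute by (simp_all flip: m_assoc)

lemma x_y_pow: "x \<otimes> y [^] (j :: nat) = z [^] j \<otimes> y [^] j \<otimes> x"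
proof (induction j)
  case (Suc j)
  have "x \<otimes> y [^] Suc j = z [^] j \<otimes> y [^] j \<otimes> x \<otimes> y" using Suc by (simp flip: m_assoc)
  also have "\<dots> = z [^] j \<otimes> (y [^] j \<otimes> z) \<otimes> y \<otimes> x" by (simp add: m_assoc xy)
  also have "y [^] j \<otimes> z = z \<otimes> y [^] j" using z_pow_commute(2)[of 1 j] by simp
  also have "z [^] j \<otimes> (z \<otimes> y [^] j) \<otimes> y \<otimes> x = z [^] Suc j \<otimes> y [^] Suc j \<otimes> x" by (simp add: m_assoc)
  finally show ?case .
qed simp

lemma x_pow_y: "x [^] (i :: nat) \<otimes> y = z [^] i \<otimes> y \<otimes> x [^] i"
proof (induction i)
  case (Suc i)
  have "x [^] Suc i \<otimes> y = x [^] i \<otimes> (x \<otimes> y)" by (simp add: m_assoc)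
  also have "\<dots> = x [^] i \<otimes> z \<otimes> y \<otimes> x" by (simp add: xy m_assoc)
  also have "x [^] i \<otimes> z = z \<otimes> x [^] i" using z_pow_commute(1)[of 1 i] by simp
  also have "z \<otimes> x [^] i \<otimes> y \<otimes> x = z \<otimes> (z [^] i \<otimes> y \<otimes> x [^] i) \<otimes> x"
    using Suc by (simp add: m_assoc)
  also have "\<dots> = (z \<otimes> z [^] i) \<otimes> y \<otimes> x [^] Suc i" by (simp add: m_assoc)
  also have "z \<otimes> z [^] i = z [^] Suc i" by (metis nat_pow_Suc2 z_closed)
  finally show ?case .
qed simp

text \<open>Moving y^3 = 1 past x must change nothing, yet it produces z^3.\<close>

lemma z_cube: "z [^] (3 :: nat) = \<one>"
  using x_y_pow[of 3] by (simp add: y_cube)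

lemma z_pow_3_mult: "z [^] (3 * k :: nat) = \<one>"
  by (metis nat_pow_one nat_pow_pow z_closed z_cube)

lemma z_pow_mod: "z [^] (k mod 3 :: nat) = z [^] (k :: nat)"
proof -
  have "z [^] k = z [^] (3 * (k div 3) + k mod 3)" by simp
  also have "\<dots> = z [^] (k mod 3)"
    by (simp only: nat_pow_mult[symmetric] z_closed z_pow_3_mult) simp
  finally show ?thesis by simp
qed

lemma z_pow_inj:
  assumes "z [^] (i :: nat) = z [^] j" "i < 3" "j < 3"
  shows "i = j"
proof -
  have zz: "z \<otimes> z \<noteq> \<one>" "z \<otimes> z \<noteq> z"
  proof
    assume "z \<otimes> z = \<one>"
    then show False using z_cube z_neq_one by (simp add: numeral_3_eq_3)
  next
    show "z \<otimes> z \<noteq> z" using z_neq_one by (simp add: r_cancel_one)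
  qed
  have "i \<in> {0, 1, 2}" "j \<in> {0, 1, 2}" using assms by auto
  then show ?thesis
    using assms(1) zz zz[symmetric] z_neq_one z_neq_one[symmetric] by (auto simp: numeral_2_eq_2)
qed

text \<open>Each interchange of y and x in this direction costs z^-1, written as z^2 so that all
  exponents stay natural numbers.\<close>

lemma y_pow_x_pow: "y [^] (j :: nat) \<otimes> x [^] (i :: nat) = x [^] i \<otimes> y [^] j \<otimes> z [^] (2 * j * i)"
proof (induction i)
  case (Suc i)
  have 1: "y [^] j \<otimes> x = x \<otimes> y [^] j \<otimes> z [^] (2 * j)"
  proof -
    have "x \<otimes> y [^] j \<otimes> z [^] (2 * j) = z [^] (2 * j) \<otimes> (x \<otimes> y [^] j)"
      using z_pow_left_commute(1)[of "y [^] j" "2 * j" 1] z_pow_commute(2)[of "2 * j" j]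
      by (simp add: m_assoc)
    also have "\<dots> = (z [^] (2 * j) \<otimes> z [^] j) \<otimes> (y [^] j \<otimes> x)" by (simp add: x_y_pow m_assoc)
    also have "z [^] (2 * j) \<otimes> z [^] j = \<one>" using z_pow_3_mult[of j] by (simp add: nat_pow_mult)
    finally show ?thesis by simp
  qed
  have "y [^] j \<otimes> x [^] Suc i = x [^] i \<otimes> y [^] j \<otimes> z [^] (2 * j * i) \<otimes> x"
    using Suc by (simp flip: m_assoc)
  also have "\<dots> = x [^] i \<otimes> (y [^] j \<otimes> x) \<otimes> z [^] (2 * j * i)"
    using z_pow_commute(1)[of "2 * j * i" 1] by (simp add: m_assoc)
  also have "\<dots> = x [^] Suc i \<otimes> y [^] j \<otimes> (z [^] (2 * j) \<otimes> z [^] (2 * j * i))"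
    unfolding 1 by (simp add: m_assoc)
  finally show ?case by (simp add: nat_pow_mult)
qed simp

fun nf :: "nat \<times> nat \<times> nat \<Rightarrow> 'a" where
  "nf (i, j, k) = x [^] i \<otimes> y [^] j \<otimes> z [^] k"

lemma nf_closed [simp]: "nf t \<in> carrier G"
  by (cases t) simp

lemma nf_mult:
  "nf (i, j, k) \<otimes> nf (i', j', k') = nf (i + i', j + j', k + k' + 2 * j * i')"
proof -
  have "nf (i, j, k) \<otimes> nf (i', j', k') =
      x [^] i \<otimes> (y [^] j \<otimes> x [^] i') \<otimes> y [^] j' \<otimes> (z [^] k \<otimes> z [^] k')"
    by (simp add: m_assoc z_pow_left_commute z_pow_commute)
  also have "\<dots> = (x [^] i \<otimes> x [^] i') \<otimes> (y [^] j \<otimes> y [^] j') \<otimes> (z [^] (2 * j * i') \<otimes> (z [^] k \<otimes> z [^] k'))"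
    unfolding y_pow_x_pow by (simp add: m_assoc z_pow_left_commute)
  also have "\<dots> = nf (i + i', j + j', k + k' + 2 * j * i')"
    by (simp add: nat_pow_mult ac_simps)
  finally show ?thesis .
qed

end

text \<open>The carry in the third component is x^3 = z^e. The function stands outside the locale
  because it must be literally the same for two different groups with equal e.\<close>

fun reduce :: "nat \<Rightarrow> nat \<times> nat \<times> nat \<Rightarrow> nat \<times> nat \<times> nat" where
  "reduce e (i, j, k) = (i mod 3, j mod 3, (k + e * (i div 3)) mod 3)"

context extraspecial_triple
begin

lemma nf_reduce: "nf (reduce e t) = nf t"
proof -
  obtain i j k where t: "t = (i, j, k)" by (cases t)
  have "x [^] i = x [^] (3 * (i div 3) + i mod 3)" by simp
  also have "\<dots> = (x [^] (3 :: nat)) [^] (i div 3) \<otimes> x [^] (i mod 3)"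
    by (simp only: nat_pow_mult nat_pow_pow x_closed)
  also have "(x [^] (3 :: nat)) [^] (i div 3) = z [^] (e * (i div 3))"
    by (simp add: x_cube nat_pow_pow)
  finally have xi: "x [^] i = x [^] (i mod 3) \<otimes> z [^] (e * (i div 3))" by (simp add: z_pow_commute)
  have "y [^] j = y [^] (3 * (j div 3) + j mod 3)" by simp
  also have "\<dots> = (y [^] (3 :: nat)) [^] (j div 3) \<otimes> y [^] (j mod 3)"
    by (simp only: nat_pow_mult nat_pow_pow y_closed)
  finally have yj: "y [^] j = y [^] (j mod 3)" by (simp add: y_cube)
  have "nf t = x [^] (i mod 3) \<otimes> (z [^] (e * (i div 3)) \<otimes> (y [^] (j mod 3) \<otimes> z [^] k))"
    by (simp add: t xi m_assoc flip: yj)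
  also have "\<dots> = x [^] (i mod 3) \<otimes> (y [^] (j mod 3) \<otimes> z [^] (k + e * (i div 3)))"
    by (simp add: z_pow_left_commute nat_pow_mult add.commute)
  finally show ?thesis by (simp add: t z_pow_mod m_assoc)
qed

text \<open>Commuting x^i y^j z^k with y yields the factor z^i, and commuting it with x yields z^j.
  As z has order 3, this recovers i and j modulo 3, and cancellation then recovers k.\<close>

lemma nf_inj:
  assumes "nf (i, j, k) = nf (i', j', k')" "i < 3" "j < 3" "k < 3" "i' < 3" "j' < 3" "k' < 3"
  shows "(i, j, k) = (i', j', k')"
proof -
  have right: "nf (i, j, k) \<otimes> y = z [^] i \<otimes> (y \<otimes> nf (i, j, k))" for i j k
  proof -
    have yy: "y [^] j \<otimes> y = y \<otimes> y [^] j" by (metis nat_pow_Suc nat_pow_Suc2 y_closed)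
    have "nf (i, j, k) \<otimes> y = x [^] i \<otimes> (y [^] j \<otimes> y) \<otimes> z [^] k"
      using z_pow_commute(2)[of k 1] by (simp add: m_assoc)
    also have "\<dots> = (x [^] i \<otimes> y) \<otimes> (y [^] j \<otimes> z [^] k)"
      unfolding yy by (simp add: m_assoc)
    finally show ?thesis unfolding x_pow_y by (simp add: m_assoc)
  qed
  have left: "x \<otimes> nf (i, j, k) = z [^] j \<otimes> (nf (i, j, k) \<otimes> x)" for i j k
  proof -
    have xx: "x \<otimes> x [^] i = x [^] i \<otimes> x" by (metis nat_pow_Suc nat_pow_Suc2 x_closed)
    have "x \<otimes> nf (i, j, k) = (x \<otimes> x [^] i) \<otimes> (y [^] j \<otimes> z [^] k)" by (simp add: m_assoc)
    also have "\<dots> = x [^] i \<otimes> (x \<otimes> y [^] j) \<otimes> z [^] k" unfolding xx by (simp add: m_assoc)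
    also have "\<dots> = z [^] j \<otimes> (x [^] i \<otimes> y [^] j \<otimes> (x \<otimes> z [^] k))"
      unfolding x_y_pow by (simp add: m_assoc z_pow_left_commute)
    finally show ?thesis using z_pow_commute(1)[of k 1] by (simp add: m_assoc)
  qed
  have "z [^] i \<otimes> (y \<otimes> nf (i, j, k)) = z [^] i' \<otimes> (y \<otimes> nf (i, j, k))"
    using right[of i j k] right[of i' j' k'] assms(1) by simp
  then have i: "i = i'" using z_pow_inj assms(2,5) by (simp del: nf.simps)
  have "z [^] j \<otimes> (nf (i, j, k) \<otimes> x) = z [^] j' \<otimes> (nf (i, j, k) \<otimes> x)"
    using left[of i j k] left[of i' j' k'] assms(1) by simp
  then have j: "j = j'" using z_pow_inj assms(3,6) by (simp del: nf.simps)
  have "z [^] k = z [^] k'" using assms(1) i j by simp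
  then show ?thesis using i j z_pow_inj assms(4,7) by simp
qed

lemma nf_eq_iff: "nf s = nf t \<longleftrightarrow> reduce e s = reduce e t"
proof
  assume "nf s = nf t"
  then have "nf (reduce e s) = nf (reduce e t)" by (simp add: nf_reduce)
  then show "reduce e s = reduce e t" by (cases s; cases t) (auto dest!: nf_inj simp del: nf.simps)
qed (metis nf_reduce)

lemma range_nf_order_27:
  assumes "order G = 27"
  shows "range nf = carrier G"
proof -
  let ?B = "{..<3} \<times> {..<3} \<times> {..<3} :: (nat \<times> nat \<times> nat) set"
  have "inj_on nf ?B" by (rule inj_onI) (auto dest!: nf_inj simp del: nf.simps)
  then have "card (nf ` ?B) = card (carrier G)" using assms by (simp add: card_image order_def)
  moreover have "finite (carrier G)" using assms order_gt_0_iff_finite by simp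
  ultimately have "nf ` ?B = carrier G" by (intro card_subset_eq) auto
  then show ?thesis by auto
qed

end

text \<open>Equality of normal forms is decided by \<open>reduce e\<close> in both groups, so
  sending \<open>G.nf t\<close> to \<open>H.nf t\<close> is well defined and injective. It is
  multiplicative because \<open>nf_mult\<close> is the same formula on exponents on both
  sides.\<close>

lemma embeds_in_triple:
  assumes "extraspecial_triple G x y z e" "extraspecial_triple H x' y' z' e"
    and surj: "carrier G \<subseteq> range (extraspecial_triple.nf G x y z)"
  shows "embeds_in G H"
proof -
  interpret G: extraspecial_triple G x y z e by fact
  interpret H: extraspecial_triple H x' y' z' e by fact
  define f where "f g = H.nf (SOME t. G.nf t = g)" for g
  have f: "f (G.nf t) = H.nf t" for t
  proof -
    have "G.nf (SOME s. G.nf s = G.nf t) = G.nf t" by (rule someI) simp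
    then show ?thesis unfolding f_def by (simp only: G.nf_eq_iff H.nf_eq_iff)
  qed
  have "f \<in> hom G H"
  proof (rule homI)
    show "f g \<in> carrier H" for g by (simp add: f_def)
    fix g h assume "g \<in> carrier G" "h \<in> carrier G"
    then obtain s t where "g = G.nf s" "h = G.nf t" using surj by blast
    then show "f (g \<otimes>\<^bsub>G\<^esub> h) = f g \<otimes>\<^bsub>H\<^esub> f h"
      by (cases s; cases t) (simp only: G.nf_mult H.nf_mult f)
  qed
  moreover have "inj_on f (carrier G)"
  proof (rule inj_onI)
    fix g h assume "g \<in> carrier G" "h \<in> carrier G" "f g = f h"
    moreover from this obtain s t where "g = G.nf s" "h = G.nf t" using surj by blast
    ultimately show "g = h" by (simp only: f G.nf_eq_iff H.nf_eq_iff)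
  qed
  ultimately show ?thesis by (auto simp: embeds_in_def)
qed

section \<open>Finding a triple in a non-abelian group of order 27\<close>

context group
begin

text \<open>Cubing is a homomorphism into the center of order 3, so among a, b, a b^-1 and a b there
  is an element of trivial cube, and it still fails to commute with a or b. It becomes y, and its
  partner becomes x. Then x^3 is 1, z or z^2, and the last case is turned into the second by a
  change of y.\<close>

lemma ex_extraspecial_triple:
  assumes ord: "order G = 27" and nonabelian: "\<not> comm_group G"
  shows "\<exists>x y z. \<exists>e \<in> {0, 1}. extraspecial_triple G x y z e"
proof -
  obtain a b where a: "a \<in> carrier G" and b: "b \<in> carrier G" and ab: "a \<otimes> b \<noteq> b \<otimes> a"
    using nonabelian group_comm_groupI by blast
  note Z = nonabelian_order_27[OF ord a b ab]
  interpret Z: normal "center G" G by (rule normal_center)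
  have cube_center: "c [^] (3 :: nat) = \<one>" if "c \<in> center G" for c
  proof -
    interpret C: group "G\<lparr>carrier := center G\<rparr>" by (rule Z.subgroup_is_group[OF is_group])
    have "c [^]\<^bsub>G\<lparr>carrier := center G\<rparr>\<^esub> order (G\<lparr>carrier := center G\<rparr>) = \<one>"
      using C.pow_order_eq_1[of c] that by simp
    then show ?thesis using Z(1) by (simp add: order_def nat_pow_consistent[symmetric])
  qed
  have center_pow: "u = \<one> \<or> u = c \<or> u = c \<otimes> c" if "c \<in> center G" "c \<noteq> \<one>" "u \<in> center G" for c u
  proof -
    have c: "c \<in> carrier G" using that center_mem by simp
    have "c \<otimes> c \<noteq> c" using that(2) c by (simp add: r_cancel_one)
    moreover have "c \<otimes> c \<noteq> \<one>"
      using cube_center[OF that(1)] that(2) c by (auto simp: numeral_3_eq_3)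
    ultimately have "card {\<one>, c, c \<otimes> c} = 3" using that(2) by auto
    moreover have "{\<one>, c, c \<otimes> c} \<subseteq> center G" using that Z.m_closed Z.one_closed by simp
    moreover have "finite (center G)" using Z(1) by (intro card_ge_0_finite) simp
    ultimately have "{\<one>, c, c \<otimes> c} = center G" using Z(1) by (intro card_subset_eq) auto
    then show ?thesis using that(3) by auto
  qed
  have cube_mult: "(g \<otimes> h) [^] (3 :: nat) = g [^] (3 :: nat) \<otimes> h [^] (3 :: nat)"
    if g: "g \<in> carrier G" and h: "h \<in> carrier G" for g h
  proof -
    define d where "d = inv h \<otimes> inv g \<otimes> h \<otimes> g"
    have "d \<in> center G" using Z(2)[of "inv h" "inv g"] g h by (simp add: d_def)
    note d = this center_mem[OF this] center_commute[OF this]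
    have hg: "h \<otimes> g = g \<otimes> h \<otimes> d"
    proof -
      have "g \<otimes> h \<otimes> d = (g \<otimes> h) \<otimes> (inv (g \<otimes> h) \<otimes> (h \<otimes> g))"
        using g h by (simp add: d_def m_assoc inv_mult_group)
      then show ?thesis using g h by (simp flip: m_assoc)
    qed
    have move: "g \<otimes> (d \<otimes> k) = d \<otimes> (g \<otimes> k)" "h \<otimes> (d \<otimes> k) = d \<otimes> (h \<otimes> k)"
      "h \<otimes> (g \<otimes> k) = d \<otimes> (g \<otimes> (h \<otimes> k))" if k: "k \<in> carrier G" for k
    proof -
      show gd: "g \<otimes> (d \<otimes> k) = d \<otimes> (g \<otimes> k)" and hd: "h \<otimes> (d \<otimes> k) = d \<otimes> (h \<otimes> k)"
        using g h d(2) k d(3)[OF g] d(3)[OF h] by (simp_all flip: m_assoc)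
      have "h \<otimes> (g \<otimes> k) = (h \<otimes> g) \<otimes> k" using g h k by (simp add: m_assoc)
      also have "\<dots> = g \<otimes> (h \<otimes> (d \<otimes> k))" unfolding hg using g h k d(2) by (simp add: m_assoc)
      also have "\<dots> = g \<otimes> (d \<otimes> (h \<otimes> k))" by (simp only: hd)
      also have "\<dots> = d \<otimes> (g \<otimes> (h \<otimes> k))" using g h k d(2) d(3)[OF g] by (simp flip: m_assoc)
      finally show "h \<otimes> (g \<otimes> k) = d \<otimes> (g \<otimes> (h \<otimes> k))" .
    qed
    \<comment> \<open>Sorting g h g h g h takes three interchanges of an h with a g. Each leaves one
      central d, and d^3 = 1.\<close>
    have "(g \<otimes> h) [^] (3 :: nat) = g \<otimes> (h \<otimes> (g \<otimes> (h \<otimes> (g \<otimes> h))))"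
      using g h by (simp add: numeral_3_eq_3 m_assoc)
    also have "\<dots> = d \<otimes> (d \<otimes> (d \<otimes> (g \<otimes> (g \<otimes> (g \<otimes> (h \<otimes> (h \<otimes> h)))))))"
      using g h d(2) by (simp add: move)
    also have "\<dots> = d [^] (3 :: nat) \<otimes> (g [^] (3 :: nat) \<otimes> h [^] (3 :: nat))"
      using g h d(2) by (simp add: numeral_3_eq_3 m_assoc)
    also have "\<dots> = g [^] (3 :: nat) \<otimes> h [^] (3 :: nat)"
      using cube_center[OF d(1)] g h by simp
    finally show ?thesis .
  qed
  have cube_in_center: "g [^] (3 :: nat) \<in> center G" if g: "g \<in> carrier G" for g
    unfolding center_def
  proof (intro CollectI conjI ballI)
    fix h assume h: "h \<in> carrier G"
    \<comment> \<open>The conjugate k of g by h differs from g by the central c, so k^3 = c^3 g^3 =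
      g^3. Hence h fixes g^3 under conjugation.\<close>
    define c where "c = h \<otimes> g \<otimes> inv h \<otimes> inv g"
    have c: "c \<in> center G" "c \<in> carrier G" using Z(2)[OF h g] center_mem by (auto simp: c_def)
    define k where "k = c \<otimes> g"
    have k: "k \<in> carrier G" "h \<otimes> g = k \<otimes> h" using g h c by (auto simp: k_def c_def m_assoc)
    have move: "h \<otimes> (g \<otimes> m) = k \<otimes> (h \<otimes> m)" if "m \<in> carrier G" for m
      using k g h that by (simp flip: m_assoc)
    have "h \<otimes> g [^] (3 :: nat) = h \<otimes> (g \<otimes> (g \<otimes> g))" using g h by (simp add: numeral_3_eq_3 m_assoc)
    also have "\<dots> = k \<otimes> (k \<otimes> (k \<otimes> h))" using g h k by (simp add: move)
    also have "\<dots> = k [^] (3 :: nat) \<otimes> h" using h k(1) by (simp add: numeral_3_eq_3 m_assoc)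
    also have "k [^] (3 :: nat) = g [^] (3 :: nat)"
      using cube_mult[OF c(2) g] cube_center[OF c(1)] g by (simp add: k_def)
    finally show "h \<otimes> g [^] (3 :: nat) = g [^] (3 :: nat) \<otimes> h" .
  qed (use g in simp)
  have "\<exists>x y. x \<in> carrier G \<and> y \<in> carrier G \<and> x \<otimes> y \<noteq> y \<otimes> x \<and> y [^] (3 :: nat) = \<one>"
  proof -
    let ?u = "a [^] (3 :: nat)" and ?v = "b [^] (3 :: nat)"
    have u: "?u \<in> center G" "?u \<in> carrier G" and v: "?v \<in> center G"
      using a b cube_in_center by auto
    \<comment> \<open>If the cube u of a is not 1, it generates the center and the cube of b is a
      power of it. The exponents 1 and 2 are cancelled by a b^-1 and by a b respectively.\<close>
    consider "?u = \<one>" | "?v = \<one>" | "?v = ?u" | "?v = ?u \<otimes> ?u"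
      using center_pow[OF u(1) _ v] by blast
    then show ?thesis
    proof cases
      case 1
      then show ?thesis using a b ab by metis
    next
      case 2
      then show ?thesis using a b ab by metis
    next
      case 3
      have "(inv b) [^] (3 :: nat) = inv ?u" using b 3 by (simp add: nat_pow_inv)
      then have "(a \<otimes> inv b) [^] (3 :: nat) = \<one>" using a b u(2) cube_mult[of a "inv b"] by simp
      moreover have "a \<otimes> (a \<otimes> inv b) \<noteq> a \<otimes> inv b \<otimes> a"
      proof
        assume "a \<otimes> (a \<otimes> inv b) = a \<otimes> inv b \<otimes> a"
        then have "inv b \<otimes> a = a \<otimes> inv b" using a b by (simp add: m_assoc)
        then show False using ab commute_inv[of "inv b" a] a b by simp
      qed
      ultimately show ?thesis using a b by (metis inv_closed m_closed)
    next
      case 4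
      have "(a \<otimes> b) [^] (3 :: nat) = ?u [^] (3 :: nat)"
        using cube_mult[OF a b] 4 u(2) by (simp add: numeral_3_eq_3 m_assoc)
      then have "(a \<otimes> b) [^] (3 :: nat) = \<one>" using cube_center[OF u(1)] by simp
      moreover have "a \<otimes> (a \<otimes> b) \<noteq> a \<otimes> b \<otimes> a" using a b ab by (simp add: m_assoc)
      ultimately show ?thesis using a b by (metis m_closed)
    qed
  qed
  then obtain x y where x: "x \<in> carrier G" and y: "y \<in> carrier G" and xy: "x \<otimes> y \<noteq> y \<otimes> x"
    and y3: "y [^] (3 :: nat) = \<one>" by blast
  define z where "z = x \<otimes> y \<otimes> inv x \<otimes> inv y"
  have z: "z \<in> center G" "z \<in> carrier G" using Z(2)[OF x y] center_mem by (auto simp: z_def)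
  have xzy: "x \<otimes> y = z \<otimes> y \<otimes> x" using x y by (simp add: z_def m_assoc)
  have z1: "z \<noteq> \<one>" using xzy xy y by auto
  have zz1: "z \<otimes> z \<noteq> \<one>"
    using cube_center[OF z(1)] z1 z(2) by (auto simp: numeral_3_eq_3)
  consider "x [^] (3 :: nat) = \<one>" | "x [^] (3 :: nat) = z" | "x [^] (3 :: nat) = z \<otimes> z"
    using center_pow[OF z(1) z1 cube_in_center[OF x]] by blast
  then show ?thesis
  proof cases
    case 1
    have "extraspecial_triple G x y z 0"
      by unfold_locales (use x y z z1 xzy y3 1 center_commute[OF z(1)] in auto)
    then show ?thesis by blast
  next
    case 2
    have "extraspecial_triple G x y z 1"
      by unfold_locales (use x y z z1 xzy y3 2 center_commute[OF z(1)] in auto)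
    then show ?thesis by blast
  next
    case 3
    \<comment> \<open>Replacing y by y^2 replaces z = [x, y] by z^2, which is the given value of
      x^3.\<close>
    have "extraspecial_triple G x (y \<otimes> y) (z \<otimes> z) 1"
    proof
      have "x \<otimes> (y \<otimes> y) = (x \<otimes> y) \<otimes> y" using x y by (simp add: m_assoc)
      also have "\<dots> = z \<otimes> y \<otimes> x \<otimes> y" by (simp only: xzy)
      also have "\<dots> = z \<otimes> y \<otimes> (x \<otimes> y)" using x y z by (simp add: m_assoc)
      also have "\<dots> = z \<otimes> (y \<otimes> z) \<otimes> y \<otimes> x" unfolding xzy using x y z by (simp add: m_assoc)
      also have "y \<otimes> z = z \<otimes> y" using center_commute[OF z(1) y] .
      finally show "x \<otimes> (y \<otimes> y) = z \<otimes> z \<otimes> (y \<otimes> y) \<otimes> x" using x y z by (simp add: m_assoc)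
      show "(y \<otimes> y) [^] (3 :: nat) = \<one>" using cube_mult[OF y y] y3 by simp
      have zz: "z \<otimes> z \<in> center G" using z(1) Z.m_closed by blast
      show "z \<otimes> z \<otimes> x = x \<otimes> (z \<otimes> z)" "z \<otimes> z \<otimes> (y \<otimes> y) = y \<otimes> y \<otimes> (z \<otimes> z)"
        using center_commute[OF zz] x y by auto
    qed (use x y z zz1 3 in auto)
    then show ?thesis by blast
  qed
qed

end

section \<open>Strands and winding numbers\<close>

text \<open>Letters act from left to right, so \<open>strand w\<close> is the inverse of the permutation \<open>braid_perm\<close>
  of \<open>w\<close>. The signed number \<open>winding w a b\<close> of crossings of the strands that start at positions \<open>a\<close> and
  \<open>b\<close> is twice their linking number when \<open>w\<close> is pure.\<close>

fun strand :: "nat group_word \<Rightarrow> nat \<Rightarrow> nat" where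
  "strand [] a = a"
| "strand ((i, e) # w) a = strand w (transpose i (i + 1) a)"

fun winding :: "nat group_word \<Rightarrow> nat \<Rightarrow> nat \<Rightarrow> int" where
  "winding [] a b = 0"
| "winding ((i, e) # w) a b =
    (if {a, b} = {i, i + 1} then (if e then 1 else -1) else 0) +
    winding w (transpose i (i + 1) a) (transpose i (i + 1) b)"

lemma strand_append: "strand (u @ v) a = strand v (strand u a)"
  by (induction u arbitrary: a) auto

lemma winding_append: "winding (u @ v) a b = winding u a b + winding v (strand u a) (strand u b)"
  by (induction u arbitrary: a b) auto

lemma inverse_word_Cons: "inverse_word ((i, e) # w) = inverse_word w @ [(i, \<not> e)]"
  by (simp add: inverse_word_def)

lemma inverse_word_Nil [simp]: "inverse_word [] = []"
  by (simp add: inverse_word_def)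

lemma strand_inverse_word [simp]: "strand (inverse_word u) (strand u a) = a"
  by (induction u arbitrary: a) (auto simp: inverse_word_Cons strand_append)

lemma strand_eq_iff [simp]: "strand u a = strand u b \<longleftrightarrow> a = b"
  by (metis strand_inverse_word)

lemma winding_inverse_word:
  "winding (inverse_word u) (strand u a) (strand u b) = - winding u a b"
proof (induction u arbitrary: a b)
  case (Cons x u)
  obtain i e where x: "x = (i, e)" by fastforce
  have "({transpose i (i + 1) a, transpose i (i + 1) b} = {i, i + 1}) = ({a, b} = {i, i + 1})"
    by (auto simp: transpose_def doubleton_eq_iff)
  then show ?case
    by (simp add: x inverse_word_Cons winding_append Cons.IH)
qed simp

lemma strand_inverse_word_id: "strand u = id \<Longrightarrow> strand (inverse_word u) = id"
  by (metis eq_id_iff strand_inverse_word)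

text \<open>As p returns every strand, the crossings of c are undone by those of its inverse. This
  reads off the linking numbers of a conjugated full twist.\<close>

lemma winding_conjugate:
  assumes "strand p = id"
  shows "winding (c @ p @ inverse_word c) a b = winding p (strand c a) (strand c b)"
  using assms by (simp add: winding_append winding_inverse_word)

lemma strand_conjugate:
  assumes "strand p = id"
  shows "strand (c @ p @ inverse_word c) = id"
  using assms by (simp add: fun_eq_iff strand_append)

lemma strand_word_rel:
  assumes "(u, v) \<in> word_rel X R" and "\<And>u v. (u, v) \<in> R \<Longrightarrow> strand u = strand v"
  shows "strand u = strand v"
  using assms by (induction rule: word_rel.induct) (auto simp: strand_append fun_eq_iff)

lemma strand_braid_relations:
  assumes "(u, v) \<in> braid_relations n"
  shows "strand u = strand v"
  using assms by (auto simp: braid_relations_def fun_eq_iff transpose_def)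

text \<open>Moves the transposition from the strands to the crossing, so that every crossing of a
  word becomes a condition on the starting positions a, b.\<close>

lemma transpose_doubleton_eq:
  "{transpose i k a, transpose i k b} = {c, d} \<longleftrightarrow> {a, b} = {transpose i k c, transpose i k d}"
  by (metis doubleton_eq_iff transpose_involutory)

text \<open>On either side of the braid relation, each pair among the strands starting at i, i + 1,
  i + 2 crosses exactly once and positively; only the order of the crossings is reversed.\<close>

lemma winding_braid_relations:
  assumes "(u, v) \<in> braid_relations n"
  shows "winding u a b = winding v a b"
  using assms unfolding braid_relations_def
proof (elim UnE CollectE exE conjE Pair_inject)
  fix i j :: nat
  assume uv: "u = [(i, True), (j, True)]" "v = [(j, True), (i, True)]" and "2 \<le> \<bar>int i - int j\<bar>"
  then have "i \<noteq> j" "i \<noteq> j + 1" "i + 1 \<noteq> j" by auto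
  then have "transpose i (i + 1) j = j" "transpose i (i + 1) (j + 1) = j + 1"
    "transpose j (j + 1) i = i" "transpose j (j + 1) (i + 1) = i + 1"
    by (auto intro!: transpose_apply_other)
  then show ?thesis
    by (simp only: uv winding.simps transpose_doubleton_eq add.commute add_0_right)
next
  fix i
  assume uv: "u = [(i, True), (i + 1, True), (i, True)]" "v = [(i + 1, True), (i, True), (i + 1, True)]"
  have "transpose i (i + 1) (i + 1 + 1) = i + 1 + 1" "transpose (i + 1) (i + 1 + 1) i = i"
    by (auto intro!: transpose_apply_other)
  then have "winding u a b = (if {a, b} = {i, i + 1} then 1 else 0) +
      ((if {a, b} = {i, i + 1 + 1} then 1 else 0) + (if {a, b} = {i + 1, i + 1 + 1} then 1 else 0))"
    "winding v a b = (if {a, b} = {i + 1, i + 1 + 1} then 1 else 0) +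
      ((if {a, b} = {i, i + 1 + 1} then 1 else 0) + (if {a, b} = {i, i + 1} then 1 else 0))"
    by (simp_all only: uv winding.simps transpose_doubleton_eq transpose_apply_first
        transpose_apply_second add_0_right if_True)
  then show ?thesis by simp
qed

lemma winding_word_rel:
  assumes "(u, v) \<in> word_rel X (braid_relations n)"
  shows "winding u = winding v"
  using assms
proof (induction rule: word_rel.induct)
  case (append u v u' v')
  then have "strand u = strand v"
    using strand_word_rel strand_braid_relations by blast
  with append.IH show ?case by (simp add: fun_eq_iff winding_append)
next
  case (cancel x b)
  show ?case by (auto simp: fun_eq_iff doubleton_eq_iff transpose_def)
next
  case (relation u v)
  then show ?case by (simp add: fun_eq_iff winding_braid_relations)
qed auto

declare One_nat_def [simp del]

section \<open>The Coxeter presentation of the symmetric group\<close>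

definition square_relations :: "nat \<Rightarrow> (nat group_word \<times> nat group_word) set" where
  "square_relations n = {([(i, True), (i, True)], []) | i. i \<in> {1..<n}}"

abbreviation coxeter_rel :: "nat \<Rightarrow> (nat group_word \<times> nat group_word) set" where
  "coxeter_rel n \<equiv> word_rel {1..<n} (braid_relations n \<union> square_relations n)"

lemma strand_coxeter_rel:
  assumes "(u, v) \<in> coxeter_rel n"
  shows "strand u = strand v"
proof (rule strand_word_rel[OF assms])
  fix u v assume "(u, v) \<in> braid_relations n \<union> square_relations n"
  then show "strand u = strand v"
    using strand_braid_relations by (auto simp: square_relations_def fun_eq_iff)
qed

lemma coxeter_rel_append:
  assumes "(u, v) \<in> coxeter_rel n" "w \<in> words {1..<n}" "w' \<in> words {1..<n}"
  shows "(w @ u @ w', w @ v @ w') \<in> coxeter_rel n"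
  using assms by (intro word_rel.append word_rel.refl)

text \<open>Lets every word be treated as a positive one modulo the squares.\<close>

lemma coxeter_rel_False:
  assumes "i \<in> {1..<n}"
  shows "([(i, False)], [(i, True)]) \<in> coxeter_rel n"
proof -
  have "([(i, True), (i, True)], []) \<in> coxeter_rel n"
    using assms by (intro word_rel.relation) (auto simp: square_relations_def)
  then have "([(i, False), (i, True), (i, True)], [(i, False)]) \<in> coxeter_rel n"
    using coxeter_rel_append[of _ "[]" n "[(i, False)]" "[]"] assms by simp
  moreover have "([(i, False), (i, True), (i, True)], [(i, True)]) \<in> coxeter_rel n"
    using coxeter_rel_append[OF word_rel.cancel, of i n "[]" "[(i, True)]" False] assms by simp
  ultimately show ?thesis by (meson word_rel.sym word_rel.trans)
qed

lemma coxeter_rel_commute: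
  assumes "i \<in> {1..<n}" "j \<in> {1..<n}" "i + 2 \<le> j \<or> j + 2 \<le> i"
  shows "([(i, True), (j, True)], [(j, True), (i, True)]) \<in> coxeter_rel n"
  using assms by (intro word_rel.relation) (auto simp: braid_relations_def)

lemma coxeter_rel_braid:
  assumes "1 \<le> i" "i + 2 \<le> n"
  shows "([(i, True), (i + 1, True), (i, True)], [(i + 1, True), (i, True), (i + 1, True)])
    \<in> coxeter_rel n"
  using assms by (intro word_rel.relation) (auto simp: braid_relations_def)

text \<open>The word (m - 1), ..., k, which carries the strand at m to position k. For 1 <= k <= m
  these words represent the right cosets of the subgroup S_(m-1) in S_m.\<close>

definition descending :: "nat \<Rightarrow> nat \<Rightarrow> nat group_word" where
  "descending m k = map (\<lambda>i. (i, True)) (rev [k..<m])"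

lemma descending_words: "1 \<le> k \<Longrightarrow> m \<le> n \<Longrightarrow> descending m k \<in> words {1..<n}"
  by (auto simp: descending_def words_def)

lemma descending_self [simp]: "descending m m = []"
  by (simp add: descending_def)

lemma descending_split: "k < m \<Longrightarrow> descending m k = descending m (Suc k) @ [(k, True)]"
  by (simp add: descending_def upt_conv_Cons)

lemma descending_split':
  assumes "k \<le> i" "i \<le> m"
  shows "descending m k = descending m i @ descending i k"
proof -
  have "[k..<m] = [k..<i] @ [i..<m]" using assms upt_add_eq_append[of k i "m - i"] by simp
  then show ?thesis by (simp add: descending_def)
qed

lemma strand_descending: "k \<le> m \<Longrightarrow> strand (descending m k) m = k"
proof (induction k rule: inc_induct)
  case (step k)
  then show ?case by (simp add: descending_split strand_append flip: Suc_eq_plus1)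
qed simp

lemma strand_descending_less: "a < k \<Longrightarrow> strand (descending m k) a = a"
proof (induction m)
  case (Suc m)
  show ?case
  proof (cases "k \<le> m")
    case True
    then have "descending (Suc m) k = (m, True) # descending m k" by (simp add: descending_def)
    then show ?thesis using Suc True by (simp add: transpose_def)
  qed (simp add: descending_def)
qed (simp add: descending_def)

lemma coxeter_rel_commute_word:
  assumes "j \<in> {1..<n}" "w \<in> words {1..<n}"
    and "\<And>i e. (i, e) \<in> set w \<Longrightarrow> e \<and> (i + 2 \<le> j \<or> j + 2 \<le> i)"
  shows "(w @ [(j, True)], (j, True) # w) \<in> coxeter_rel n"
  using assms(2,3)
proof (induction w)
  case Nil
  then show ?case using assms(1) by (auto intro: word_rel.refl)
next
  case (Cons x w)
  obtain i where x: "x = (i, True)" using Cons.prems(2)[of "fst x" "snd x"] by (cases x) auto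
  have i: "i \<in> {1..<n}" "w \<in> words {1..<n}" using Cons.prems(1) x by auto
  have "(w @ [(j, True)], (j, True) # w) \<in> coxeter_rel n"
    by (rule Cons.IH[OF i(2)]) (use Cons.prems(2) in auto)
  then have "(x # w @ [(j, True)], x # (j, True) # w) \<in> coxeter_rel n"
    using coxeter_rel_append[of _ _ n "[x]" "[]"] i x by simp
  moreover have "(x # (j, True) # w, (j, True) # x # w) \<in> coxeter_rel n"
    using coxeter_rel_append[OF coxeter_rel_commute[of i n j], of "[]" w] i x assms(1) Cons.prems(2)[of i True]
    by simp
  ultimately show ?case by (auto intro: word_rel.trans)
qed

lemma coxeter_rel_descending_low:
  assumes "1 \<le> j" "j + 2 \<le> k" "k \<le> m" "m \<le> n"
  shows "(descending m k @ [(j, True)], (j, True) # descending m k) \<in> coxeter_rel n"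
proof (rule coxeter_rel_commute_word)
  show "descending m k \<in> words {1..<n}" using assms by (intro descending_words) auto
qed (use assms in \<open>auto simp: descending_def\<close>)

text \<open>The word contains the factor j, j - 1. The appended j passes the smaller letters after
  it, the braid relation turns j, j - 1, j into j - 1, j, j - 1, and the front j - 1 passes the
  letters above j.\<close>

lemma coxeter_rel_descending_high:
  assumes "1 \<le> k" "k < j" "j < m" "m \<le> n"
  shows "(descending m k @ [(j, True)], (j - 1, True) # descending m k) \<in> coxeter_rel n"
proof -
  obtain i where j: "j = Suc i" using assms by (cases j) auto
  define D where "D = descending m (Suc (Suc i))"
  define E where "E = descending i k"
  have words: "D \<in> words {1..<n}" "E \<in> words {1..<n}"
    unfolding D_def E_def using assms j by (auto intro!: descending_words)
  have "descending m k = descending m i @ descending i k"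
    using assms j by (intro descending_split') auto
  also have "descending m i = D @ [(Suc i, True), (i, True)]"
    using assms j by (simp add: D_def descending_split)
  finally have split: "descending m k = D @ [(Suc i, True), (i, True)] @ E" by (simp add: E_def)
  have mem: "i \<in> {1..<n}" "Suc i \<in> {1..<n}" using assms j by auto
  have "(E @ [(Suc i, True)], (Suc i, True) # E) \<in> coxeter_rel n"
    using words mem by (intro coxeter_rel_commute_word) (auto simp: E_def descending_def)
  then have "(descending m k @ [(j, True)], D @ [(Suc i, True), (i, True), (Suc i, True)] @ E) \<in> coxeter_rel n"
    using coxeter_rel_append[of _ _ n "D @ [(Suc i, True), (i, True)]" "[]"] words mem j
    by (simp add: split)
  also have "(D @ [(Suc i, True), (i, True), (Suc i, True)] @ E,
      D @ [(i, True), (Suc i, True), (i, True)] @ E) \<in> coxeter_rel n"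
    using coxeter_rel_append[OF word_rel.sym[OF coxeter_rel_braid[of i n]]] words mem
    by (simp flip: Suc_eq_plus1)
  also (word_rel.trans) have "(D @ [(i, True), (Suc i, True), (i, True)] @ E,
      (i, True) # D @ [(Suc i, True), (i, True)] @ E) \<in> coxeter_rel n"
  proof -
    have "(D @ [(i, True)], (i, True) # D) \<in> coxeter_rel n"
      unfolding D_def using assms j by (intro coxeter_rel_descending_low) auto
    from coxeter_rel_append[OF this, of "[]" "[(Suc i, True), (i, True)] @ E"] show ?thesis
      using words mem by simp
  qed
  finally (word_rel.trans) show ?thesis by (simp add: split j)
qed

text \<open>Coset enumeration: a letter j appended to \<open>descending (Suc m) k\<close> passes
  through unchanged, lengthens the word, cancels its last letter, or passes through as j - 1. The
  four cases are j <= k - 2, j = k - 1, j = k and j > k.\<close>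

lemma coxeter_rel_coset:
  assumes "m < n" "w \<in> words {1..<Suc m}"
  shows "\<exists>u \<in> words {1..<m}. \<exists>k \<in> {1..Suc m}. (w, u @ descending (Suc m) k) \<in> coxeter_rel n"
  using assms(2)
proof (induction w rule: rev_induct)
  case Nil
  show ?case by (intro bexI[of _ "[]"] bexI[of _ "Suc m"]) (auto intro: word_rel.refl)
next
  case (snoc x w)
  obtain j e where x: "x = (j, e)" by fastforce
  obtain u k where u: "u \<in> words {1..<m}" and k: "k \<in> {1..Suc m}"
    and w: "(w, u @ descending (Suc m) k) \<in> coxeter_rel n"
    using snoc by auto
  have j: "j \<in> {1..<Suc m}" "j \<in> {1..<n}" using snoc.prems x assms(1) by auto
  have u': "u \<in> words {1..<n}" using u assms(1) by (auto simp: words_def)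
  have "([(j, e)], [(j, True)]) \<in> coxeter_rel n"
    using coxeter_rel_False[OF j(2)] j by (cases e) (auto intro: word_rel.refl)
  from word_rel.append[OF w this]
  have 1: "(w @ [x], u @ descending (Suc m) k @ [(j, True)]) \<in> coxeter_rel n" by (simp add: x)
  have tail: "\<exists>u \<in> words {1..<m}. \<exists>k \<in> {1..Suc m}. (w @ [x], u @ descending (Suc m) k) \<in> coxeter_rel n"
    if "v \<in> words {1..<m}" "l \<in> {1..Suc m}"
      "(descending (Suc m) k @ [(j, True)], v @ descending (Suc m) l) \<in> coxeter_rel n" for v l
  proof (rule bexI[of _ "u @ v"], rule bexI[of _ l])
    have "(u @ (descending (Suc m) k @ [(j, True)]), u @ (v @ descending (Suc m) l)) \<in> coxeter_rel n"
      using coxeter_rel_append[OF that(3) u', of "[]"] by simp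
    with 1 show "(w @ [x], (u @ v) @ descending (Suc m) l) \<in> coxeter_rel n"
      by (auto intro: word_rel.trans)
  qed (use u that in auto)
  consider "j + 2 \<le> k" | "k = j + 1" | "j = k" | "k < j" by linarith
  then show ?case
  proof cases
    case 1
    with j k assms(1) coxeter_rel_descending_low[of j k "Suc m" n] show ?thesis
      by (intro tail[of "[(j, True)]" k]) auto
  next
    case 2
    then have "descending (Suc m) k @ [(j, True)] = descending (Suc m) j"
      using j by (simp add: descending_split flip: Suc_eq_plus1)
    then show ?thesis
      using j descending_words[of j "Suc m" n] assms(1)
      by (intro tail[of "[]" j]) (auto intro: word_rel.refl)
  next
    case 3
    have "([(j, True), (j, True)], []) \<in> coxeter_rel n"
      using j by (intro word_rel.relation) (auto simp: square_relations_def)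
    from coxeter_rel_append[OF this, of "descending (Suc m) (Suc j)" "[]"]
    have "(descending (Suc m) k @ [(j, True)], descending (Suc m) (Suc j)) \<in> coxeter_rel n"
      using j 3 descending_words[of "Suc j" "Suc m" n] assms(1) descending_split[of j "Suc m"] by simp
    then show ?thesis using j by (intro tail[of "[]" "Suc j"]) auto
  next
    case 4
    with j k assms(1) coxeter_rel_descending_high[of k j "Suc m" n] show ?thesis
      by (intro tail[of "[(j - 1, True)]" k]) auto
  qed
qed

text \<open>The subgroup factor u never touches the top position \<open>Suc m\<close>, whereas the
  coset factor sends it to k. Since w fixes it, k = \<open>Suc m\<close>, the coset factor is empty,
  and w reduces to a word in fewer letters.\<close>

theorem coxeter_presentation:
  assumes "w \<in> words {1..<n}" "strand w = id"
  shows "(w, []) \<in> coxeter_rel n"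
proof -
  have "(w, []) \<in> coxeter_rel n" if "m \<le> n" "w \<in> words {1..<m}" "strand w = id" for m w
    using that
  proof (induction m arbitrary: w)
    case 0
    then show ?case by (cases w) (auto intro: word_rel.refl)
  next
    case (Suc m)
    obtain u k where u: "u \<in> words {1..<m}" and k: "k \<in> {1..Suc m}"
      and w: "(w, u @ descending (Suc m) k) \<in> coxeter_rel n"
      using coxeter_rel_coset[of m n w] Suc.prems by auto
    have fix_top: "strand u (Suc m) = Suc m"
      using u by (induction u) (auto simp: transpose_def)
    have "Suc m = strand (u @ descending (Suc m) k) (Suc m)"
      using strand_coxeter_rel[OF w] Suc.prems(3) by (metis id_apply)
    also have "\<dots> = k" using k by (simp add: strand_append fix_top strand_descending)
    finally have "(w, u) \<in> coxeter_rel n" using w by (metis append_Nil2 descending_self)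
    moreover have "(u, []) \<in> coxeter_rel n"
      using Suc.IH[OF _ u] Suc.prems strand_coxeter_rel[OF \<open>(w, u) \<in> coxeter_rel n\<close>] by simp
    ultimately show ?case by (rule word_rel.trans)
  qed
  then show ?thesis using assms by blast
qed

section \<open>Braid words modulo commutators of pure braids\<close>

lemma (in group) eval_word_inverse_word:
  assumes "w \<in> words X" "f ` X \<subseteq> carrier G"
  shows "eval_word G f (inverse_word w) = inv (eval_word G f w)"
proof -
  have "eval_word G f (inverse_word w @ w) = eval_word G f []"
    using eval_word_rel[OF inverse_word_cancel[OF assms(1), of "{}"] assms(2)] by simp
  then show ?thesis
    using assms eval_word_append[OF inverse_word_words[OF assms(1)] assms]
      eval_word_closed[OF inverse_word_words[OF assms(1)] assms(2)] eval_word_closed[OF assms]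
    by (metis inv_equality eval_word.simps(1))
qed

lemma (in group_hom) eval_word_hom:
  assumes "w \<in> words X" "f ` X \<subseteq> carrier G"
  shows "h (eval_word G f w) = eval_word H (h \<circ> f) w"
  using assms
proof (induction w)
  case (Cons x w)
  then show ?case
    using G.eval_word_closed[of w X f] by (cases x) (auto simp: image_subset_iff)
qed simp

lemma (in group) conj_conj:
  assumes "g \<in> carrier G" "h \<in> carrier G" "x \<in> carrier G"
  shows "g \<otimes> (h \<otimes> x \<otimes> inv h) \<otimes> inv g = (g \<otimes> h) \<otimes> x \<otimes> inv (g \<otimes> h)"
  using assms by (simp add: m_assoc inv_mult_group)

lemma (in group) conj_eq_self:
  assumes "g \<in> carrier G" "x \<in> carrier G" "g \<otimes> x = x \<otimes> g"
  shows "g \<otimes> x \<otimes> inv g = x"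
  using assms by (simp add: m_assoc)

text \<open>Collects what is needed of the quotient in terms of words instead of cosets of classes.
  Purity of a word is expressed as \<open>strand w = id\<close>; the last assumption says that
  crossing numbers survive in the quotient and is what makes the generators of the pure part
  independent.\<close>

locale abelianized_braids = group G for G (structure) +
  fixes n :: nat and s :: "nat \<Rightarrow> 'a"
  assumes s_image: "s ` {1..<n} \<subseteq> carrier G"
    and eval_relation: "\<And>u v. (u, v) \<in> braid_relations n \<Longrightarrow> eval_word G s u = eval_word G s v"
    and eval_surj: "\<And>x. x \<in> carrier G \<Longrightarrow> \<exists>w \<in> words {1..<n}. x = eval_word G s w"
    and pure_commute: "\<And>u v. \<lbrakk>u \<in> words {1..<n}; v \<in> words {1..<n}; strand u = id; strand v = id\<rbrakk>
      \<Longrightarrow> eval_word G s u \<otimes> eval_word G s v = eval_word G s v \<otimes> eval_word G s u"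
    and eval_winding: "\<And>u v. \<lbrakk>u \<in> words {1..<n}; v \<in> words {1..<n}; eval_word G s u = eval_word G s v\<rbrakk>
      \<Longrightarrow> winding u = winding v"
begin

abbreviation ev :: "nat group_word \<Rightarrow> 'a" where
  "ev \<equiv> eval_word G s"

definition conj_by :: "nat \<Rightarrow> 'a \<Rightarrow> 'a" where
  "conj_by k x = s k \<otimes> x \<otimes> inv (s k)"

text \<open>The standard pure braid A_ij: strand j is carried next to strand i, the two make a full
  twist, and strand j is carried back.\<close>

definition A_word :: "nat \<Rightarrow> nat \<Rightarrow> nat group_word" where
  "A_word i j = descending j (Suc i) @ [(i, True), (i, True)] @ inverse_word (descending j (Suc i))"

abbreviation A :: "nat \<Rightarrow> nat \<Rightarrow> 'a" where
  "A i j \<equiv> ev (A_word i j)"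

lemma s_closed [simp]: "i \<in> {1..<n} \<Longrightarrow> s i \<in> carrier G"
  using s_image by auto

lemma ev_closed [simp]: "w \<in> words {1..<n} \<Longrightarrow> ev w \<in> carrier G"
  using eval_word_closed s_image by blast

lemma ev_append: "u \<in> words {1..<n} \<Longrightarrow> v \<in> words {1..<n} \<Longrightarrow> ev (u @ v) = ev u \<otimes> ev v"
  using eval_word_append s_image by blast

lemma ev_inverse: "u \<in> words {1..<n} \<Longrightarrow> ev (inverse_word u) = inv (ev u)"
  using eval_word_inverse_word s_image by blast

lemma s_commute:
  assumes "i \<in> {1..<n}" "j \<in> {1..<n}" "i + 2 \<le> j \<or> j + 2 \<le> i"
  shows "s i \<otimes> s j = s j \<otimes> s i"
proof -
  have "([(i, True), (j, True)], [(j, True), (i, True)]) \<in> braid_relations n"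
    using assms by (auto simp: braid_relations_def)
  from eval_relation[OF this] show ?thesis using assms by simp
qed

lemma s_braid:
  assumes "i \<in> {1..<n}" "Suc i \<in> {1..<n}"
  shows "s i \<otimes> (s (Suc i) \<otimes> s i) = s (Suc i) \<otimes> (s i \<otimes> s (Suc i))"
proof -
  have "([(i, True), (i + 1, True), (i, True)], [(i + 1, True), (i, True), (i + 1, True)])
      \<in> braid_relations n"
    using assms by (auto simp: braid_relations_def)
  from eval_relation[OF this] show ?thesis using assms by (simp flip: Suc_eq_plus1)
qed

lemma conj_by_closed [simp]: "k \<in> {1..<n} \<Longrightarrow> x \<in> carrier G \<Longrightarrow> conj_by k x \<in> carrier G"
  by (simp add: conj_by_def)

lemma conj_by_commute:
  assumes "i \<in> {1..<n}" "j \<in> {1..<n}" "i + 2 \<le> j \<or> j + 2 \<le> i" "x \<in> carrier G"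
  shows "conj_by i (conj_by j x) = conj_by j (conj_by i x)"
  using assms s_commute[OF assms(1-3)] unfolding conj_by_def by (simp only: conj_conj s_closed)

lemma conj_by_braid:
  assumes "i \<in> {1..<n}" "Suc i \<in> {1..<n}" "x \<in> carrier G"
  shows "conj_by i (conj_by (Suc i) (conj_by i x)) = conj_by (Suc i) (conj_by i (conj_by (Suc i) x))"
  using assms s_braid[OF assms(1,2)] unfolding conj_by_def
  by (simp only: conj_conj s_closed m_closed)

lemma conj_by_ev:
  assumes "k \<in> {1..<n}" "u \<in> words {1..<n}"
  shows "conj_by k (ev u) = ev ((k, True) # u @ [(k, False)])"
  using assms by (simp add: conj_by_def ev_append m_assoc)

lemma conj_by_conj_by:
  assumes "k \<in> {1..<n}" "u \<in> words {1..<n}" "strand u = id"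
  shows "conj_by k (conj_by k (ev u)) = ev u"
proof -
  have "s k \<otimes> s k \<otimes> ev u = ev u \<otimes> (s k \<otimes> s k)"
    using pure_commute[of "[(k, True), (k, True)]" u] assms by (simp add: fun_eq_iff)
  with assms conj_eq_self[of "s k \<otimes> s k" "ev u"] show ?thesis
    unfolding conj_by_def by (simp add: conj_conj)
qed

lemma A_word_words: "1 \<le> i \<Longrightarrow> i < j \<Longrightarrow> j \<le> n \<Longrightarrow> A_word i j \<in> words {1..<n}"
  unfolding A_word_def by (auto intro!: inverse_word_words descending_words)

lemma strand_A_word: "strand (A_word i j) = id"
  unfolding A_word_def by (rule strand_conjugate) (simp add: fun_eq_iff)

lemma A_Suc_self: "A i (Suc i) = ev [(i, True), (i, True)]"
  by (simp add: A_word_def)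

lemma A_Suc:
  assumes "1 \<le> i" "i < j" "j < n"
  shows "A i (Suc j) = conj_by j (A i j)"
proof -
  have "A_word i (Suc j) = (j, True) # A_word i j @ [(j, False)]"
    using assms by (simp add: A_word_def descending_def inverse_word_Cons)
  then show ?thesis using assms conj_by_ev A_word_words by auto
qed

lemma A_closed [simp]: "1 \<le> i \<Longrightarrow> i < j \<Longrightarrow> j \<le> n \<Longrightarrow> A i j \<in> carrier G"
  by (simp add: A_word_words)

section \<open>Conjugation permutes the standard pure generators\<close>

lemma conj_by_square:
  assumes "k \<in> {1..<n}" "i \<in> {1..<n}" "k + 2 \<le> i \<or> i + 2 \<le> k \<or> k = i"
  shows "conj_by k (A i (Suc i)) = A i (Suc i)"
proof -
  have *: "s k \<otimes> s i = s i \<otimes> s k" using assms s_commute by blast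
  have "s k \<otimes> (s i \<otimes> s i) = s i \<otimes> s k \<otimes> s i"
    using assms * by (simp flip: m_assoc)
  also have "\<dots> = s i \<otimes> s i \<otimes> s k" using assms * by (simp add: m_assoc)
  finally have "s k \<otimes> (s i \<otimes> s i) = (s i \<otimes> s i) \<otimes> s k" .
  with assms conj_eq_self[of "s k" "s i \<otimes> s i"] show ?thesis
    by (simp add: A_Suc_self conj_by_def)
qed

text \<open>With x = s_i and y = s_(i+1), the braid relation makes y conjugate x y^2 x^-1 to x^2.
  Conjugating once more by y gives y x^2 y^-1, which is A_(i,i+2), while two conjugations by y act
  trivially on pure elements.\<close>

lemma conj_by_square_adjacent:
  assumes "i \<in> {1..<n}" "Suc i \<in> {1..<n}"
  shows "conj_by i (A (Suc i) (Suc (Suc i))) = A i (Suc (Suc i))"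
proof -
  let ?x = "s i" and ?y = "s (Suc i)"
  let ?u = "[(i, True), (Suc i, True), (Suc i, True), (i, False)]"
  have c: "?x \<in> carrier G" "?y \<in> carrier G" using assms by auto
  have u: "?u \<in> words {1..<n}" "strand ?u = id" using assms by (auto simp: fun_eq_iff)
  have "?y \<otimes> (?x \<otimes> (?y \<otimes> ?y)) = (?y \<otimes> (?x \<otimes> ?y)) \<otimes> ?y"
    using c by (simp add: m_assoc)
  also have "\<dots> = ?x \<otimes> (?y \<otimes> (?x \<otimes> ?y))"
    using c by (subst s_braid[OF assms, symmetric]) (simp add: m_assoc)
  also have "\<dots> = ?x \<otimes> (?x \<otimes> (?y \<otimes> ?x))"
    unfolding s_braid[OF assms] ..
  finally have *: "?y \<otimes> (?x \<otimes> (?y \<otimes> ?y)) = ?x \<otimes> (?x \<otimes> (?y \<otimes> ?x))" .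
  have "conj_by (Suc i) (ev ?u) = (?y \<otimes> (?x \<otimes> (?y \<otimes> ?y))) \<otimes> inv ?x \<otimes> inv ?y"
    using c by (simp add: conj_by_def m_assoc)
  also have "\<dots> = ev [(i, True), (i, True)]"
    unfolding * using c by (simp add: m_assoc)
  finally have "conj_by (Suc i) (conj_by (Suc i) (ev ?u)) = A i (Suc (Suc i))"
    using A_Suc[of i "Suc i"] assms by (simp add: A_Suc_self)
  moreover have "conj_by i (A (Suc i) (Suc (Suc i))) = ev ?u"
    using c by (simp add: A_Suc_self conj_by_def m_assoc)
  ultimately show ?thesis using conj_by_conj_by[of "Suc i" ?u] u assms by simp
qed

lemma conj_by_A_high:
  assumes "1 \<le> i" "i < j" "j < k" "k < n"
  shows "conj_by k (A i j) = A i j"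
proof -
  have "Suc i \<le> j" using assms by simp
  then show ?thesis using assms
  proof (induction j rule: dec_induct)
    case base
    then show ?case by (intro conj_by_square) auto
  next
    case (step j)
    then show ?case using conj_by_commute[of k j "A i j"] by (simp add: A_Suc)
  qed
qed

lemma conj_by_A_low:
  assumes "1 \<le> k" "Suc k < i" "i < j" "j \<le> n"
  shows "conj_by k (A i j) = A i j"
proof -
  have "Suc i \<le> j" using assms by simp
  then show ?thesis using assms
  proof (induction j rule: dec_induct)
    case base
    then show ?case by (intro conj_by_square) auto
  next
    case (step j)
    then show ?case using conj_by_commute[of k j "A i j"] by (simp add: A_Suc)
  qed
qed

text \<open>In the base case A_(i,k+2) is A_(i,k) conjugated by s_k and then by s_(k+1). The braid
  relation moves the extra s_k inward, where it becomes an s_(k+1) that fixes A_(i,k).\<close>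

lemma conj_by_A_mid:
  assumes "1 \<le> i" "i < k" "Suc k < j" "j \<le> n"
  shows "conj_by k (A i j) = A i j"
proof -
  have "Suc (Suc k) \<le> j" using assms by simp
  then show ?thesis using assms
  proof (induction j rule: dec_induct)
    case base
    then have "conj_by k (A i (Suc (Suc k))) = conj_by k (conj_by (Suc k) (conj_by k (A i k)))"
      by (simp add: A_Suc)
    also have "\<dots> = conj_by (Suc k) (conj_by k (conj_by (Suc k) (A i k)))"
      using base by (intro conj_by_braid) auto
    also have "\<dots> = A i (Suc (Suc k))"
      using base by (simp add: conj_by_A_high A_Suc)
    finally show ?case .
  next
    case (step j)
    then show ?case using conj_by_commute[of k j "A i j"] by (simp add: A_Suc)
  qed
qed

lemma conj_by_A_left:
  assumes "1 \<le> i" "Suc i < j" "j \<le> n"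
  shows "conj_by i (A (Suc i) j) = A i j"
proof -
  have "Suc (Suc i) \<le> j" using assms by simp
  then show ?thesis using assms
  proof (induction j rule: dec_induct)
    case base
    then show ?case by (intro conj_by_square_adjacent) auto
  next
    case (step j)
    then show ?case using conj_by_commute[of i j "A (Suc i) j"] by (simp add: A_Suc)
  qed
qed

definition pairs :: "(nat \<times> nat) set" where
  "pairs = {(i, j). 1 \<le> i \<and> i < j \<and> j \<le> n}"

definition A_set :: "'a set" where
  "A_set = (\<lambda>(i, j). A i j) ` pairs"

lemma A_in_A_set: "1 \<le> i \<Longrightarrow> i < j \<Longrightarrow> j \<le> n \<Longrightarrow> A i j \<in> A_set"
  by (force simp: A_set_def pairs_def)

lemma A_set_cases:
  assumes "x \<in> A_set"
  obtains i j where "1 \<le> i" "i < j" "j \<le> n" "x = A i j"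
  using assms by (auto simp: A_set_def pairs_def)

lemma A_set_subset: "A_set \<subseteq> carrier G"
  by (auto elim!: A_set_cases)

text \<open>The index pair undergoes the transposition of k and k + 1. Where the index j drops to k,
  or the index i = k rises, x is itself the \<open>conj_by k\<close> of the wanted generator, and
  \<open>conj_by k\<close> is an involution on pure elements.\<close>

lemma conj_by_A_set:
  assumes "k \<in> {1..<n}" "x \<in> A_set"
  shows "conj_by k x \<in> A_set"
  using assms(2)
proof (cases rule: A_set_cases)
  case (1 i j)
  consider "j < k" | "k = j" | "i < k" "Suc k = j" | "i < k" "Suc k < j" | "k = i" "j = Suc i"
    | "k = i" "Suc i < j" | "Suc k = i" | "Suc k < i" using 1 by linarith
  then show ?thesis
  proof cases
    case c: 1
    then show ?thesis using 1 assms conj_by_A_high A_in_A_set by simp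
  next
    case 2
    then show ?thesis using 1 assms A_Suc[of i j] A_in_A_set[of i "Suc j"] by simp
  next
    case 3
    then have "x = conj_by k (A i k)" using 1 A_Suc[of i k] by auto
    then show ?thesis
      using 1 3 assms conj_by_conj_by[OF _ A_word_words strand_A_word] A_in_A_set by simp
  next
    case 4
    then show ?thesis using 1 conj_by_A_mid A_in_A_set by simp
  next
    case 5
    then show ?thesis using 1 assms conj_by_square A_in_A_set by simp
  next
    case 6
    then have "x = conj_by i (A (Suc i) j)" using 1 conj_by_A_left by simp
    then show ?thesis
      using 1 6 assms conj_by_conj_by[OF _ A_word_words strand_A_word] A_in_A_set by simp
  next
    case 7
    then show ?thesis using 1 assms conj_by_A_left[of k j] A_in_A_set by simp
  next
    case 8
    then show ?thesis using 1 assms conj_by_A_low A_in_A_set by simp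
  qed
qed

lemma conj_ev_A_set:
  assumes "w \<in> words {1..<n}" "x \<in> A_set"
  shows "ev w \<otimes> x \<otimes> inv (ev w) \<in> A_set"
  using assms(1)
proof (induction w)
  case Nil
  then show ?case using assms(2) A_set_subset by auto
next
  case (Cons y w)
  obtain k e where y: "y = (k, e)" by fastforce
  define z where "z = ev w \<otimes> x \<otimes> inv (ev w)"
  have k: "k \<in> {1..<n}" and w: "w \<in> words {1..<n}" using Cons.prems y by auto
  have z: "z \<in> A_set" using Cons.IH[OF w] by (simp add: z_def)
  then obtain i j where ij: "1 \<le> i" "i < j" "j \<le> n" "z = A i j" by (rule A_set_cases)
  have c: "x \<in> carrier G" "z \<in> carrier G" using assms(2) z A_set_subset by auto
  have "ev (y # w) \<otimes> x \<otimes> inv (ev (y # w)) = conj_by k z" if e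
    using that k w c y unfolding z_def conj_by_def by (simp add: conj_conj)
  moreover have "ev (y # w) \<otimes> x \<otimes> inv (ev (y # w)) = conj_by k z" if "\<not> e"
  proof -
    have "ev (y # w) \<otimes> x \<otimes> inv (ev (y # w)) = inv (s k) \<otimes> z \<otimes> inv (inv (s k))"
      using that k w c y unfolding z_def by (simp only: conj_conj ev_closed inv_closed s_closed) simp
    \<comment> \<open>Rewriting z as a double conjugate lets the inverse letter cancel one of the
      two, so a letter and its inverse act alike.\<close>
    also have "z = conj_by k (conj_by k z)"
      using conj_by_conj_by[OF k A_word_words strand_A_word] ij by simp
    also have "inv (s k) \<otimes> \<dots> \<otimes> inv (inv (s k)) = conj_by k z"
      unfolding conj_by_def[of k "conj_by k z"]
      using k c conj_conj[of "inv (s k)" "s k" "conj_by k z"] by simp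
    finally show ?thesis .
  qed
  ultimately show ?case using conj_by_A_set[OF k z] by metis
qed

section \<open>Generation and independence in the pure part\<close>

lemma generate_A_set_normal: "generate G A_set \<lhd> G"
  using conj_ev_A_set eval_surj by (intro normal_generateI A_set_subset) metis

text \<open>Modulo the normal subgroup generated by the A_ij every s_i^2 = A_(i,i+1) dies, so the
  Coxeter relations hold in the quotient. There a word with trivial permutation must be
  trivial.\<close>

lemma pure_in_generate:
  assumes "w \<in> words {1..<n}" "strand w = id"
  shows "ev w \<in> generate G A_set"
proof -
  define N where "N = generate G A_set"
  interpret N: normal N G unfolding N_def by (rule generate_A_set_normal)
  interpret q: group_hom G "G Mod N" "\<lambda>x. N #> x"
    by (simp add: N.factorgroup_is_group N.r_coset_hom_Mod group_hom_axioms.intro group_hom_def is_group)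
  let ?f = "(\<lambda>x. N #> x) \<circ> s"
  have f: "?f ` {1..<n} \<subseteq> carrier (G Mod N)" using s_image by auto
  have q: "eval_word (G Mod N) ?f u = N #> ev u" if "u \<in> words {1..<n}" for u
    using q.eval_word_hom[OF that s_image] by simp
  have "eval_word (G Mod N) ?f w = eval_word (G Mod N) ?f []"
  proof (rule q.H.eval_word_rel[OF coxeter_presentation[OF assms] f])
    fix u v assume uv: "(u, v) \<in> braid_relations n \<union> square_relations n"
      "u \<in> words {1..<n}" "v \<in> words {1..<n}"
    show "eval_word (G Mod N) ?f u = eval_word (G Mod N) ?f v"
    proof (cases "(u, v) \<in> braid_relations n")
      case True
      then show ?thesis using uv q eval_relation by simp
    next
      case False
      then obtain i where i: "i \<in> {1..<n}" "u = [(i, True), (i, True)]" "v = []"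
        using uv by (auto simp: square_relations_def)
      then have "ev u \<in> N"
        using A_in_A_set[of i "Suc i"] unfolding N_def by (auto simp: A_Suc_self intro: generate.incl)
      then have "N #> ev u = N #> ev v"
        using i N.rcos_const by (simp add: coset_mult_one N.subset)
      then show ?thesis by (metis q uv(2,3))
    qed
  qed
  then have "N #> ev w = N #> \<one>" using q[of w] q[of "[]"] assms by simp
  then show ?thesis
    unfolding N_def[symmetric]
    using assms N.subgroup_axioms by (metis coset_join1 coset_mult_one ev_closed N.subset)
qed

text \<open>Up to the factor 2 of a full twist, the linking numbers are the coordinates dual to the
  A_ij.\<close>

lemma winding_A_word:
  assumes "(i, j) \<in> pairs" "(a, b) \<in> pairs"
  shows "winding (A_word i j) a b = (if (a, b) = (i, j) then 2 else 0)"
proof -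
  let ?c = "descending j (Suc i)"
  have "strand ?c j = Suc i" "strand ?c i = i"
    using assms by (auto simp: pairs_def strand_descending strand_descending_less)
  then have "({strand ?c a, strand ?c b} = {i, Suc i}) = ({a, b} = {i, j})"
    by (metis doubleton_eq_iff strand_eq_iff)
  moreover have "winding (A_word i j) a b = winding [(i, True), (i, True)] (strand ?c a) (strand ?c b)"
    unfolding A_word_def by (rule winding_conjugate) (simp add: fun_eq_iff)
  moreover have "winding [(i, True), (i, True)] a b = (if {a, b} = {i, Suc i} then 2 else 0)" for a b
    by (auto simp: doubleton_eq_iff transpose_def)
  ultimately show ?thesis using assms by (auto simp: pairs_def doubleton_eq_iff)
qed

text \<open>A commutative group of its own, which makes \<open>finprod\<close> available inside the
  non-commutative G.\<close>

definition pure_group :: "'a monoid" where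
  "pure_group = \<lparr>carrier = ev ` {w \<in> words {1..<n}. strand w = id}, mult = (\<otimes>), one = \<one>\<rparr>"

lemma pure_group_simps: "x \<otimes>\<^bsub>pure_group\<^esub> y = x \<otimes> y" "\<one>\<^bsub>pure_group\<^esub> = \<one>"
  by (simp_all add: pure_group_def)

lemma comm_group_pure: "comm_group pure_group"
proof (rule comm_groupI)
  fix x y assume "x \<in> carrier pure_group" "y \<in> carrier pure_group"
  then obtain u v where uv: "u \<in> words {1..<n}" "v \<in> words {1..<n}" "strand u = id" "strand v = id"
    and xy: "x = ev u" "y = ev v" by (auto simp: pure_group_def)
  show "x \<otimes>\<^bsub>pure_group\<^esub> y \<in> carrier pure_group"
    unfolding pure_group_def xy
    using uv by (auto intro!: image_eqI[of _ _ "u @ v"] simp: ev_append fun_eq_iff strand_append)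
  show "x \<otimes>\<^bsub>pure_group\<^esub> y = y \<otimes>\<^bsub>pure_group\<^esub> x"
    using uv pure_commute by (simp add: pure_group_def xy)
next
  show "\<one>\<^bsub>pure_group\<^esub> \<in> carrier pure_group"
    by (auto simp: pure_group_def fun_eq_iff intro!: image_eqI[of _ _ "[]"])
next
  fix x assume x: "x \<in> carrier pure_group"
  then show "\<one>\<^bsub>pure_group\<^esub> \<otimes>\<^bsub>pure_group\<^esub> x = x" by (auto simp: pure_group_def)
  from x obtain u where u: "u \<in> words {1..<n}" "strand u = id" "x = ev u" by (auto simp: pure_group_def)
  show "\<exists>y \<in> carrier pure_group. y \<otimes>\<^bsub>pure_group\<^esub> x = \<one>\<^bsub>pure_group\<^esub>"
  proof (rule bexI[of _ "ev (inverse_word u)"])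
    show "ev (inverse_word u) \<in> carrier pure_group"
      unfolding pure_group_def using u by (auto simp: strand_inverse_word_id inverse_word_words)
  qed (use u in \<open>simp add: pure_group_def ev_inverse\<close>)
qed (auto simp: pure_group_def m_assoc)

text \<open>A word is carried along with the product of powers because crossings can only be counted
  on words; the factor 2 matches the full twists.\<close>

definition represents :: "nat group_word \<Rightarrow> (nat \<times> nat \<Rightarrow> int) \<Rightarrow> 'a \<Rightarrow> bool" where
  "represents u e y \<longleftrightarrow> u \<in> words {1..<n} \<and> strand u = id \<and> ev u = y \<and>
    (\<forall>p \<in> pairs. winding u (fst p) (snd p) = 2 * e p) \<and>
    y = finprod pure_group (\<lambda>p. A (fst p) (snd p) [^]\<^bsub>pure_group\<^esub> e p) pairs"

text \<open>Exponents and crossing numbers of pure words are both additive, so only the letters need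
  work. There the exponent vector is 1 or -1 at a single pair.\<close>

lemma ex_represents:
  assumes "y \<in> generate G A_set"
  shows "\<exists>u e. represents u e y"
proof -
  interpret P: comm_group pure_group by (rule comm_group_pure)
  have fin: "finite pairs"
    by (rule finite_subset[of _ "{1..n} \<times> {1..n}"]) (auto simp: pairs_def)
  have A: "A (fst p) (snd p) \<in> carrier pure_group" if "p \<in> pairs" for p
    using that A_word_words strand_A_word by (auto simp: pure_group_def pairs_def)
  have letter: "\<exists>u e. represents u e (A i j)" "\<exists>u e. represents u e (inv (A i j))" if ij: "(i, j) \<in> pairs" for i j
  proof -
    have single: "finprod pure_group
        (\<lambda>p. A (fst p) (snd p) [^]\<^bsub>pure_group\<^esub> (if (i, j) = p then c else 0 :: int)) pairs
        = A i j [^]\<^bsub>pure_group\<^esub> c" for c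
    proof -
      let ?f = "\<lambda>p. A (fst p) (snd p) [^]\<^bsub>pure_group\<^esub> c"
      have "(\<lambda>p. A (fst p) (snd p) [^]\<^bsub>pure_group\<^esub> (if (i, j) = p then c else 0 :: int)) =
        (\<lambda>p. if (i, j) = p then ?f p else \<one>\<^bsub>pure_group\<^esub>)"
        by (rule ext) simp
      moreover have "finprod pure_group (\<lambda>p. if (i, j) = p then ?f p else \<one>\<^bsub>pure_group\<^esub>) pairs = ?f (i, j)"
        using A by (intro P.finprod_singleton ij fin Pi_I P.int_pow_closed)
      ultimately show ?thesis by simp
    qed
    have w: "A_word i j \<in> words {1..<n}" using ij A_word_words by (auto simp: pairs_def)
    have Aij: "A i j \<in> carrier pure_group" using A[OF ij] by simp
    have inv: "inv\<^bsub>pure_group\<^esub> (A i j) = inv (A i j)"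
    proof (rule P.inv_equality)
      show "inv (A i j) \<otimes>\<^bsub>pure_group\<^esub> A i j = \<one>\<^bsub>pure_group\<^esub>"
        using w by (simp add: pure_group_def)
      have "ev (inverse_word (A_word i j)) \<in> carrier pure_group"
        unfolding pure_group_def
        using w by (auto simp: strand_inverse_word_id strand_A_word inverse_word_words)
      then show "inv (A i j) \<in> carrier pure_group" using w by (simp add: ev_inverse)
    qed (rule Aij)
    have wind: "winding (A_word i j) (fst p) (snd p) = (if (i, j) = p then 2 else 0)" if "p \<in> pairs" for p
      using winding_A_word[OF ij, of "fst p" "snd p"] that by (auto split: if_splits)
    have "represents (A_word i j) (\<lambda>p. if (i, j) = p then 1 else 0) (A i j)"
      unfolding represents_def using w strand_A_word wind single[of 1] P.int_pow_1[OF Aij] by simp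
    then show "\<exists>u e. represents u e (A i j)" by blast
    have wind': "winding (inverse_word (A_word i j)) a b = - winding (A_word i j) a b" for a b
      using winding_inverse_word[of "A_word i j" a b] by (simp add: strand_A_word)
    have "A i j [^]\<^bsub>pure_group\<^esub> (- 1 :: int) = inv (A i j)"
      using P.int_pow_neg[OF Aij, of 1] P.int_pow_1[OF Aij] inv by simp
    then have "represents (inverse_word (A_word i j)) (\<lambda>p. if (i, j) = p then -1 else 0) (inv (A i j))"
      unfolding represents_def using w wind wind' single[of "-1"] strand_inverse_word_id[OF strand_A_word]
      by (simp add: ev_inverse inverse_word_words)
    then show "\<exists>u e. represents u e (inv (A i j))" by blast
  qed
  from assms show ?thesis
  proof (induction rule: generate.induct)
    case one
    have "\<one>\<^bsub>pure_group\<^esub> =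
        finprod pure_group (\<lambda>p. A (fst p) (snd p) [^]\<^bsub>pure_group\<^esub> (0 :: int)) pairs"
      by simp
    then have "\<one> = finprod pure_group (\<lambda>p. A (fst p) (snd p) [^]\<^bsub>pure_group\<^esub> (0 :: int)) pairs"
      by (simp only: pure_group_simps)
    then have "represents [] (\<lambda>_. 0) \<one>" unfolding represents_def by (auto simp: fun_eq_iff)
    then show ?case by blast
  next
    case (incl h)
    then obtain i j where "(i, j) \<in> pairs" "h = A i j" by (auto simp: A_set_def)
    then show ?case using letter(1) by metis
  next
    case (inv h)
    then obtain i j where "(i, j) \<in> pairs" "h = A i j" by (auto simp: A_set_def)
    then show ?case using letter(2) by metis
  next
    case (eng h1 h2)
    from eng.IH obtain u e v f where P: "represents u e h1" "represents v f h2" by blast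
    let ?B = "\<lambda>e p. A (fst p) (snd p) [^]\<^bsub>pure_group\<^esub> (e p :: int)"
    have B: "?B e \<in> pairs \<rightarrow> carrier pure_group" for e
      using A by (intro Pi_I P.int_pow_closed)
    have "finprod pure_group (?B (\<lambda>p. e p + f p)) pairs =
        finprod pure_group (\<lambda>p. ?B e p \<otimes>\<^bsub>pure_group\<^esub> ?B f p) pairs"
    proof (rule P.finprod_cong'[OF HOL.refl])
      show "(\<lambda>p. ?B e p \<otimes>\<^bsub>pure_group\<^esub> ?B f p) \<in> pairs \<rightarrow> carrier pure_group"
        using B by (intro Pi_I P.m_closed) blast+
      show "?B (\<lambda>p. e p + f p) p = ?B e p \<otimes>\<^bsub>pure_group\<^esub> ?B f p" if "p \<in> pairs" for p
        using A[OF that] by (rule P.int_pow_mult)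
    qed
    also have "\<dots> = finprod pure_group (?B e) pairs \<otimes>\<^bsub>pure_group\<^esub> finprod pure_group (?B f) pairs"
      by (rule P.finprod_multf[OF B B])
    also have "finprod pure_group (?B e) pairs = h1"
      using P(1) unfolding represents_def by (elim conjE) (rule HOL.sym)
    also have "finprod pure_group (?B f) pairs = h2"
      using P(2) unfolding represents_def by (elim conjE) (rule HOL.sym)
    finally have "h1 \<otimes> h2 = finprod pure_group (?B (\<lambda>p. e p + f p)) pairs"
      by (simp only: pure_group_simps)
    moreover have "u @ v \<in> words {1..<n}" "strand (u @ v) = id" "ev (u @ v) = h1 \<otimes> h2"
      using P by (auto simp: represents_def ev_append strand_append fun_eq_iff)
    moreover have "\<forall>p \<in> pairs. winding (u @ v) (fst p) (snd p) = 2 * (e p + f p)"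
      using P by (simp add: represents_def winding_append)
    ultimately have "represents (u @ v) (\<lambda>p. e p + f p) (h1 \<otimes> h2)"
      unfolding represents_def by blast
    then show ?case by blast
  qed
qed

text \<open>The word u read off from the product of the A_ij may differ from w, but both have the
  same value and hence the same crossing numbers. If these vanish, so do all exponents.\<close>

theorem ev_eq_one:
  assumes "w \<in> words {1..<n}" "strand w = id"
    and "\<And>a b. 1 \<le> a \<Longrightarrow> a < b \<Longrightarrow> b \<le> n \<Longrightarrow> winding w a b = 0"
  shows "ev w = \<one>"
proof -
  interpret P: comm_group pure_group by (rule comm_group_pure)
  obtain u e where "represents u e (ev w)"
    using ex_represents[OF pure_in_generate[OF assms(1,2)]] by blast
  then have u: "u \<in> words {1..<n}" "ev u = ev w"
    and e: "\<forall>p \<in> pairs. winding u (fst p) (snd p) = 2 * e p"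
    and w: "ev w = finprod pure_group (\<lambda>p. A (fst p) (snd p) [^]\<^bsub>pure_group\<^esub> e p) pairs"
    by (auto simp: represents_def)
  have "winding u = winding w" using eval_winding u assms(1) by blast
  then have "e p = 0" if "p \<in> pairs" for p
    using e assms(3)[of "fst p" "snd p"] that by (auto simp: pairs_def)
  then have "ev w = \<one>\<^bsub>pure_group\<^esub>" unfolding w by (intro P.finprod_one_eqI) simp
  then show ?thesis by (simp add: pure_group_def)
qed

end

lemma (in group) commutator_mult:
  assumes "x \<in> carrier G" "y \<in> carrier G"
  shows "x \<otimes> y \<otimes> inv x \<otimes> inv y \<otimes> (y \<otimes> x) = x \<otimes> y"
proof -
  have "inv x \<otimes> inv y \<otimes> (y \<otimes> x) = \<one>"
    using assms by (simp flip: inv_mult_group)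
  then show ?thesis using assms by (simp add: m_assoc)
qed

section \<open>The braid quotient as an instance\<close>

lemma inv_presented_group:
  assumes "w \<in> words X"
  shows "inv\<^bsub>presented_group X R\<^esub> (word_rel X R `` {w}) = word_rel X R `` {inverse_word w}"
proof (rule group.inv_equality[OF group_presented_group])
  show "word_rel X R `` {inverse_word w} \<otimes>\<^bsub>presented_group X R\<^esub> word_rel X R `` {w} =
      \<one>\<^bsub>presented_group X R\<^esub>"
    using assms equiv_class_eq[OF equiv_word_rel inverse_word_cancel[OF assms]]
    by (simp add: mult_presented_group inverse_word_words one_presented_group)
qed (use assms in \<open>auto intro: class_in_presented_group inverse_word_words\<close>)

lemma eval_word_presented_group:
  assumes "w \<in> words X"
  shows "eval_word (presented_group X R) (\<lambda>x. word_rel X R `` {[(x, True)]}) w = word_rel X R `` {w}"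
  using assms
proof (induction w)
  case (Cons y w)
  obtain x b where y: "y = (x, b)" by fastforce
  have x: "[(x, True)] \<in> words X" "[(x, b)] \<in> words X" "w \<in> words X" using Cons.prems y by auto
  have "(if b then word_rel X R `` {[(x, True)]}
      else inv\<^bsub>presented_group X R\<^esub> (word_rel X R `` {[(x, True)]})) = word_rel X R `` {[(x, b)]}"
    by (simp add: inv_presented_group[OF x(1)] inverse_word_Cons)
  then show ?case using Cons.IH x mult_presented_group[OF x(2,3)] by (simp add: y)
qed (simp add: one_presented_group)

context
  fixes n :: nat
begin

abbreviation braid_class :: "nat group_word \<Rightarrow> nat group_word set" where
  "braid_class w \<equiv> word_rel {1..<n} (braid_relations n) `` {w}"

definition quotient_gen :: "nat \<Rightarrow> nat group_word set set" where
  "quotient_gen i =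
    derived (braid_group n) (pure_braid_group n) #>\<^bsub>braid_group n\<^esub> braid_class [(i, True)]"

lemma group_braid_group: "group (braid_group n)"
  by (simp add: braid_group_def group_presented_group)

lemma braid_perm_group_hom: "group_hom (braid_group n) (sym_group n) (braid_perm n)"
  using group_braid_group braid_perm_hom sym_group_is_group
  by (simp add: group_hom_def group_hom_axioms_def)

lemma derived_pure_normal: "derived (braid_group n) (pure_braid_group n) \<lhd> braid_group n"
  unfolding pure_braid_group_def
  by (intro group.derived_is_normal group_braid_group group_hom.normal_kernel braid_perm_group_hom)

lemma strand_eval_word_sym:
  assumes "w \<in> words {1..<n}"
  shows "strand w (eval_word (sym_group n) (\<lambda>i. transpose i (i + 1)) w a) = a"
  using assms
proof (induction w arbitrary: a)
  case (Cons x w)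
  obtain i e where x: "x = (i, e)" by fastforce
  have "transpose i (i + 1) \<in> carrier (sym_group n)"
    using Cons.prems x transpose_in_sym_group[of n] by (simp add: image_subset_iff)
  then have "inv\<^bsub>sym_group n\<^esub> (transpose i (i + 1)) = transpose i (i + 1)"
    by (simp add: inv_equality)
  then show ?case using Cons by (simp add: x sym_group_mult)
qed (simp add: sym_group_one)

lemma braid_class_pure_iff:
  assumes "w \<in> words {1..<n}"
  shows "braid_class w \<in> pure_braid_group n \<longleftrightarrow> strand w = id"
proof -
  let ?p = "eval_word (sym_group n) (\<lambda>i. transpose i (i + 1)) w"
  have "braid_perm n (braid_class w) = ?p"
    unfolding braid_perm_def using assms
    by (intro group.presented_map_class sym_group_is_group transpose_in_sym_group braid_relations_sym_group)
  moreover have "?p = id \<longleftrightarrow> strand w = id"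
    using strand_eval_word_sym[OF assms] by (metis eq_id_iff strand_eq_iff)
  ultimately show ?thesis
    using class_in_presented_group[OF assms, of "braid_relations n"]
    by (simp add: pure_braid_group_def kernel_def braid_group_def sym_group_one)
qed

text \<open>On pure words crossing numbers are additive, so they vanish on commutators. The classes
  of pure words with vanishing crossing numbers form a subgroup, which therefore contains the
  derived one.\<close>

lemma derived_pure_winding:
  assumes "d \<in> derived (braid_group n) (pure_braid_group n)"
  shows "\<exists>w \<in> words {1..<n}. strand w = id \<and> (\<forall>a b. winding w a b = 0) \<and> d = braid_class w"
proof -
  interpret B: group "braid_group n" by (rule group_braid_group)
  define H where "H = braid_class ` {w \<in> words {1..<n}. strand w = id \<and> (\<forall>a b. winding w a b = 0)}"
  have mult: "braid_class u \<otimes>\<^bsub>braid_group n\<^esub> braid_class v = braid_class (u @ v)"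
    if "u \<in> words {1..<n}" "v \<in> words {1..<n}" for u v
    unfolding braid_group_def by (rule mult_presented_group[OF that])
  have inv: "inv\<^bsub>braid_group n\<^esub> (braid_class u) = braid_class (inverse_word u)"
    if "u \<in> words {1..<n}" for u
    unfolding braid_group_def by (rule inv_presented_group[OF that])
  have wind_inv: "winding (inverse_word u) a b = - winding u a b" if "strand u = id" for u a b
    using winding_inverse_word[of u a b] that by simp
  have "subgroup H (braid_group n)"
  proof
    show "H \<subseteq> carrier (braid_group n)"
      unfolding H_def braid_group_def by (auto intro: class_in_presented_group)
    show "\<one>\<^bsub>braid_group n\<^esub> \<in> H"
      unfolding H_def braid_group_def one_presented_group
      by (rule image_eqI[of _ _ "[]"]) (auto simp: fun_eq_iff)
    fix x assume "x \<in> H"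
    then obtain u where u: "x = braid_class u" "u \<in> words {1..<n}" "strand u = id" "\<forall>a b. winding u a b = 0"
      by (auto simp: H_def)
    show "inv\<^bsub>braid_group n\<^esub> x \<in> H"
      unfolding H_def
      by (rule image_eqI[of _ _ "inverse_word u"])
        (use u in \<open>auto simp: inv inverse_word_words strand_inverse_word_id wind_inv\<close>)
    fix y assume "y \<in> H"
    then obtain v where v: "y = braid_class v" "v \<in> words {1..<n}" "strand v = id" "\<forall>a b. winding v a b = 0"
      by (auto simp: H_def)
    show "x \<otimes>\<^bsub>braid_group n\<^esub> y \<in> H"
      unfolding H_def
      by (rule image_eqI[of _ _ "u @ v"])
        (use u v in \<open>auto simp: mult fun_eq_iff strand_append winding_append\<close>)
  qed
  moreover have "derived_set (braid_group n) (pure_braid_group n) \<subseteq> H"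
  proof
    fix x assume "x \<in> derived_set (braid_group n) (pure_braid_group n)"
    then obtain p q where pq: "p \<in> pure_braid_group n" "q \<in> pure_braid_group n"
      and x: "x = p \<otimes>\<^bsub>braid_group n\<^esub> q \<otimes>\<^bsub>braid_group n\<^esub> inv\<^bsub>braid_group n\<^esub> p \<otimes>\<^bsub>braid_group n\<^esub> inv\<^bsub>braid_group n\<^esub> q"
      by blast
    from pq have "p \<in> carrier (braid_group n)" "q \<in> carrier (braid_group n)"
      by (auto simp: pure_braid_group_def kernel_def)
    then obtain u v where uv: "u \<in> words {1..<n}" "v \<in> words {1..<n}" "p = braid_class u" "q = braid_class v"
      unfolding braid_group_def by (metis presented_group_cases)
    then have s: "strand u = id" "strand v = id" using pq braid_class_pure_iff by auto
    show "x \<in> H"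
      unfolding H_def
      by (rule image_eqI[of _ _ "u @ v @ inverse_word u @ inverse_word v"])
        (use uv s in \<open>auto simp: x inv mult inverse_word_words fun_eq_iff strand_append winding_append
          strand_inverse_word_id wind_inv\<close>)
  qed
  ultimately have "derived (braid_group n) (pure_braid_group n) \<subseteq> H"
    unfolding derived_def by (intro B.generate_subgroup_incl)
  then show ?thesis using assms by (auto simp: H_def)
qed

lemma eval_word_quotient_gen:
  assumes "w \<in> words {1..<n}"
  shows "eval_word (braid_quotient n) quotient_gen w =
    derived (braid_group n) (pure_braid_group n) #>\<^bsub>braid_group n\<^esub> braid_class w"
proof -
  define D where "D = derived (braid_group n) (pure_braid_group n)"
  interpret D: normal D "braid_group n" unfolding D_def by (rule derived_pure_normal)
  interpret q: group_hom "braid_group n" "braid_group n Mod D" "\<lambda>x. D #>\<^bsub>braid_group n\<^esub> x"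
    by (simp add: D.factorgroup_is_group D.r_coset_hom_Mod group_hom_axioms.intro group_hom_def D.is_group)
  let ?f = "\<lambda>i. braid_class [(i, True)]"
  have f: "?f ` {1..<n} \<subseteq> carrier (braid_group n)"
    unfolding braid_group_def by (auto intro!: class_in_presented_group)
  have "quotient_gen = (\<lambda>x. D #>\<^bsub>braid_group n\<^esub> x) \<circ> ?f"
    by (auto simp: quotient_gen_def D_def)
  then show ?thesis
    using q.eval_word_hom[OF assms f] eval_word_presented_group[OF assms, of "braid_relations n"]
    by (simp add: braid_quotient_def D_def flip: braid_group_def)
qed

lemma abelianized_braids_quotient: "abelianized_braids (braid_quotient n) n quotient_gen"
proof -
  define D where "D = derived (braid_group n) (pure_braid_group n)"
  interpret D: normal D "braid_group n" unfolding D_def by (rule derived_pure_normal)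
  interpret Q: group "braid_quotient n"
    unfolding braid_quotient_def D_def[symmetric] by (rule D.factorgroup_is_group)
  have ev: "eval_word (braid_quotient n) quotient_gen w = D #>\<^bsub>braid_group n\<^esub> braid_class w"
    if "w \<in> words {1..<n}" for w
    using eval_word_quotient_gen[OF that] by (simp add: D_def)
  have cl: "braid_class w \<in> carrier (braid_group n)" if "w \<in> words {1..<n}" for w
    unfolding braid_group_def by (rule class_in_presented_group[OF that])
  have mult: "braid_class u \<otimes>\<^bsub>braid_group n\<^esub> braid_class v = braid_class (u @ v)"
    if "u \<in> words {1..<n}" "v \<in> words {1..<n}" for u v
    unfolding braid_group_def by (rule mult_presented_group[OF that])
  have cosets: "\<exists>d \<in> D. x = d \<otimes>\<^bsub>braid_group n\<^esub> y"
    if "D #>\<^bsub>braid_group n\<^esub> x = D #>\<^bsub>braid_group n\<^esub> y" "x \<in> carrier (braid_group n)" for x y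
  proof -
    have "x \<in> D #>\<^bsub>braid_group n\<^esub> y"
      using D.rcos_self[OF that(2) D.subgroup_axioms] that(1) by simp
    then show ?thesis by (auto simp: r_coset_def)
  qed
  have s_image: "quotient_gen ` {1..<n} \<subseteq> carrier (braid_quotient n)"
    using cl[of "[(i, True)]" for i]
    by (fastforce simp: braid_quotient_def quotient_gen_def FactGroup_def RCOSETS_def)
  show ?thesis
  proof
    show "quotient_gen ` {1..<n} \<subseteq> carrier (braid_quotient n)" by (rule s_image)
  next
    fix u v assume uv: "(u, v) \<in> braid_relations n"
    then have w: "u \<in> words {1..<n}" "v \<in> words {1..<n}"
      by (auto simp: braid_relations_def)
    then have "braid_class u = braid_class v"
      using uv by (intro equiv_class_eq[OF equiv_word_rel] word_rel.relation)
    then show "eval_word (braid_quotient n) quotient_gen u = eval_word (braid_quotient n) quotient_gen v"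
      using w ev by simp
  next
    fix x assume "x \<in> carrier (braid_quotient n)"
    then obtain b where b: "b \<in> carrier (braid_group n)" "x = D #>\<^bsub>braid_group n\<^esub> b"
      by (auto simp: braid_quotient_def FactGroup_def RCOSETS_def D_def)
    then obtain w where "w \<in> words {1..<n}" "b = braid_class w"
      unfolding braid_group_def by (metis presented_group_cases)
    then show "\<exists>w \<in> words {1..<n}. x = eval_word (braid_quotient n) quotient_gen w"
      using b ev by metis
  next
    fix u v assume uv: "u \<in> words {1..<n}" "v \<in> words {1..<n}" "strand u = id" "strand v = id"
    let ?x = "braid_class u" and ?y = "braid_class v"
    have c: "?x \<in> carrier (braid_group n)" "?y \<in> carrier (braid_group n)" using uv cl by auto
    define d where "d = ?x \<otimes>\<^bsub>braid_group n\<^esub> ?y \<otimes>\<^bsub>braid_group n\<^esub> inv\<^bsub>braid_group n\<^esub> ?x \<otimes>\<^bsub>braid_group n\<^esub> inv\<^bsub>braid_group n\<^esub> ?y"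
    have "d \<in> D"
      unfolding D_def derived_def d_def
      using uv braid_class_pure_iff by (intro generate.incl) blast
    have "?x \<otimes>\<^bsub>braid_group n\<^esub> ?y = d \<otimes>\<^bsub>braid_group n\<^esub> (?y \<otimes>\<^bsub>braid_group n\<^esub> ?x)"
      unfolding d_def using c D.commutator_mult by simp
    then have "D #>\<^bsub>braid_group n\<^esub> (?x \<otimes>\<^bsub>braid_group n\<^esub> ?y) =
        (D #>\<^bsub>braid_group n\<^esub> d) #>\<^bsub>braid_group n\<^esub> (?y \<otimes>\<^bsub>braid_group n\<^esub> ?x)"
      using D.coset_mult_assoc[OF D.subset, of d "?y \<otimes>\<^bsub>braid_group n\<^esub> ?x"] c \<open>d \<in> D\<close> D.subset
      by auto
    also have "D #>\<^bsub>braid_group n\<^esub> d = D"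
      using \<open>d \<in> D\<close> D.subset by (intro D.coset_join2 D.subgroup_axioms) auto
    finally have "D #>\<^bsub>braid_group n\<^esub> (?x \<otimes>\<^bsub>braid_group n\<^esub> ?y) =
        D #>\<^bsub>braid_group n\<^esub> (?y \<otimes>\<^bsub>braid_group n\<^esub> ?x)" .
    moreover have "u @ v \<in> words {1..<n}" "v @ u \<in> words {1..<n}" using uv by auto
    ultimately show "eval_word (braid_quotient n) quotient_gen u \<otimes>\<^bsub>braid_quotient n\<^esub>
        eval_word (braid_quotient n) quotient_gen v =
        eval_word (braid_quotient n) quotient_gen v \<otimes>\<^bsub>braid_quotient n\<^esub>
        eval_word (braid_quotient n) quotient_gen u"
      using uv Q.eval_word_append[OF _ _ s_image] ev mult by metis
  next
    fix u v assume uv: "u \<in> words {1..<n}" "v \<in> words {1..<n}"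
      "eval_word (braid_quotient n) quotient_gen u = eval_word (braid_quotient n) quotient_gen v"
    then have "D #>\<^bsub>braid_group n\<^esub> braid_class u = D #>\<^bsub>braid_group n\<^esub> braid_class v" by (simp add: ev)
    from cosets[OF this cl[OF uv(1)]] obtain d
      where d: "d \<in> D" "braid_class u = d \<otimes>\<^bsub>braid_group n\<^esub> braid_class v" by blast
    \<comment> \<open>Words with equal cosets differ by a prefix w representing an element of the
      derived subgroup. Such a prefix moves no strand and adds nothing to any crossing
      number.\<close>
    obtain w where w: "w \<in> words {1..<n}" "strand w = id" "\<forall>a b. winding w a b = 0" "d = braid_class w"
      using derived_pure_winding d(1) D_def by auto
    have "braid_class u = braid_class (w @ v)" using d(2) w mult uv by simp
    then have "(u, w @ v) \<in> word_rel {1..<n} (braid_relations n)"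
      using uv w by (simp add: eq_equiv_class_iff[OF equiv_word_rel])
    from winding_word_rel[OF this] show "winding u = winding v"
      using w by (simp add: fun_eq_iff winding_append)
  qed
qed

end

section \<open>Explicit braids\<close>

text \<open>An evaluable form of \<open>winding\<close>: sets and transpositions are replaced by
  equality tests, and the count is carried as an argument.\<close>

fun winding_acc :: "nat group_word \<Rightarrow> nat \<Rightarrow> nat \<Rightarrow> int \<Rightarrow> int" where
  "winding_acc [] a b c = c"
| "winding_acc ((i, e) # w) a b c =
    (if a = i then
       if b = Suc i then winding_acc w (Suc i) i (if e then c + 1 else c - 1)
       else winding_acc w (Suc i) b c
     else if a = Suc i then
       if b = i then winding_acc w i (Suc i) (if e then c + 1 else c - 1)
       else winding_acc w i b c
     else if b = i then winding_acc w a (Suc i) c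
     else if b = Suc i then winding_acc w a i c
     else winding_acc w a b c)"

text \<open>For a = b the tests would move one copy of the strand and leave the other behind, hence
  the restriction to distinct positions.\<close>

lemma winding_acc_eq: "a \<noteq> b \<Longrightarrow> winding_acc w a b c = c + winding w a b"
  by (induction w a b c rule: winding_acc.induct)
    (auto simp: doubleton_eq_iff transpose_def simp flip: Suc_eq_plus1)

lemma strand_code [code]:
  "strand [] a = a"
  "strand ((i, e) # w) a = strand w (if a = i then Suc i else if a = Suc i then i else a)"
  by (auto simp: transpose_def simp flip: Suc_eq_plus1)

text \<open>Recursion over lists instead of bounded quantifiers: below a binder \<open>code_simp\<close> would
  unfold \<open>strand\<close> and \<open>winding_acc\<close> on a variable, with exponentially many case distinctions.\<close>

primrec letters_below :: "nat \<Rightarrow> nat group_word \<Rightarrow> bool" where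
  "letters_below n [] \<longleftrightarrow> True"
| "letters_below n (x # w) \<longleftrightarrow> 1 \<le> fst x \<and> fst x < n \<and> letters_below n w"

primrec unlinked_with :: "nat group_word \<Rightarrow> nat \<Rightarrow> nat list \<Rightarrow> bool" where
  "unlinked_with w a [] \<longleftrightarrow> True"
| "unlinked_with w a (b # bs) \<longleftrightarrow> winding_acc w a b 0 = 0 \<and> unlinked_with w a bs"

primrec unlinked :: "nat group_word \<Rightarrow> nat list \<Rightarrow> bool" where
  "unlinked w [] \<longleftrightarrow> True"
| "unlinked w (a # as) \<longleftrightarrow> strand w a = a \<and> unlinked_with w a as \<and> unlinked w as"

text \<open>Letters stop at n - 1, but strands occupy the positions 1 to n, hence the bound
  \<open>Suc n\<close>.\<close>

definition trivial_word :: "nat \<Rightarrow> nat group_word \<Rightarrow> bool" where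
  "trivial_word n w \<longleftrightarrow> letters_below n w \<and> unlinked w [1..<Suc n]"

lemma letters_below_words: "letters_below n w \<Longrightarrow> w \<in> words {1..<n}"
  by (induction w) auto

lemma unlinked_with_iff: "a \<notin> set bs \<Longrightarrow> unlinked_with w a bs \<longleftrightarrow> (\<forall>b \<in> set bs. winding w a b = 0)"
  by (induction bs) (auto simp: winding_acc_eq)

lemma unlinked_upt:
  "unlinked w [m..<n] \<Longrightarrow> m \<le> a \<Longrightarrow> a < n \<Longrightarrow>
    strand w a = a \<and> (\<forall>b. a < b \<longrightarrow> b < n \<longrightarrow> winding w a b = 0)"
proof (induction "n - m" arbitrary: m)
  case (Suc k)
  then have "[m..<n] = m # [Suc m..<n]" by (simp add: upt_conv_Cons)
  then have m: "strand w m = m" "\<forall>b \<in> set [Suc m..<n]. winding w m b = 0" "unlinked w [Suc m..<n]"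
    using Suc.prems(1) by (simp_all add: unlinked_with_iff)
  show ?case
  proof (cases "a = m")
    case True
    then show ?thesis using m by simp
  next
    case False
    then show ?thesis using Suc.hyps(1)[of "Suc m"] Suc.hyps(2) Suc.prems m(3) by simp
  qed
qed simp

text \<open>Turns a check of finitely many positions into an equality with \<open>id\<close> on all
  natural numbers.\<close>

lemma strand_fixes_outside:
  "w \<in> words {1..<n} \<Longrightarrow> a \<notin> {1..n} \<Longrightarrow> strand w a = a"
  by (induction w) (auto simp: transpose_def)

abbreviation commutator_word :: "'b group_word \<Rightarrow> 'b group_word \<Rightarrow> 'b group_word" where
  "commutator_word u v \<equiv> u @ v @ inverse_word u @ inverse_word v"

context abelianized_braids
begin

lemma trivial_word_ev:
  assumes "trivial_word n w"
  shows "ev w = \<one>"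
proof (rule ev_eq_one)
  have w: "letters_below n w" "unlinked w [1..<Suc n]" using assms by (simp_all add: trivial_word_def)
  then show words: "w \<in> words {1..<n}" by (intro letters_below_words)
  have "strand w a = a" for a
    using unlinked_upt[OF w(2), of a] strand_fixes_outside[OF words, of a] by (cases "a \<in> {1..n}") auto
  then show "strand w = id" by (simp add: fun_eq_iff)
  show "winding w a b = 0" if "1 \<le> a" "a < b" "b \<le> n" for a b
    using unlinked_upt[OF w(2), of a] that by simp
qed

lemma trivial_commutator_word:
  assumes "u \<in> words {1..<n}" "v \<in> words {1..<n}" "trivial_word n (commutator_word u v)"
  shows "ev u \<otimes> ev v = ev v \<otimes> ev u"
proof -
  have "ev (commutator_word u v) = ev u \<otimes> ev v \<otimes> inv (ev u) \<otimes> inv (ev v)"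
    using assms(1,2) by (simp add: ev_append ev_inverse inverse_word_words m_assoc)
  then have "ev u \<otimes> ev v \<otimes> inv (ev u) \<otimes> inv (ev v) = \<one>"
    using trivial_word_ev[OF assms(3)] by simp
  then show ?thesis
    using commutator_mult[of "ev u" "ev v"] assms(1,2) by simp
qed

text \<open>Each relation becomes the triviality of one explicit word, with x^3 = z^e written as x^3
  z^-e. Since crossing numbers depend only on the value of a word, a single non-zero one shows that
  z is not 1.\<close>

lemma extraspecial_triple_words:
  fixes u v defines "w \<equiv> commutator_word u v"
  assumes words: "u \<in> words {1..<n}" "v \<in> words {1..<n}"
    and rels: "trivial_word n (commutator_word w u)" "trivial_word n (commutator_word w v)"
      "trivial_word n (v @ v @ v)"
      "trivial_word n (u @ u @ u @ concat (replicate e (inverse_word w)))"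
    and nontrivial: "a \<noteq> b" "winding_acc w a b 0 \<noteq> 0"
  shows "extraspecial_triple G (ev u) (ev v) (ev w) e"
proof
  have w: "w \<in> words {1..<n}" using words by (simp add: w_def inverse_word_words)
  have evw: "ev w = ev u \<otimes> ev v \<otimes> inv (ev u) \<otimes> inv (ev v)"
    unfolding w_def using words by (simp add: ev_append ev_inverse inverse_word_words m_assoc)
  show "ev u \<otimes> ev v = ev w \<otimes> ev v \<otimes> ev u"
    unfolding evw using commutator_mult[of "ev u" "ev v"] words by (simp add: m_assoc)
  show "ev w \<otimes> ev u = ev u \<otimes> ev w" "ev w \<otimes> ev v = ev v \<otimes> ev w"
    using words w rels by (auto intro: trivial_commutator_word)
  show "ev v [^] (3 :: nat) = \<one>"
    using trivial_word_ev[OF rels(3)] words by (simp add: ev_append numeral_3_eq_3 m_assoc)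
  have rep: "concat (replicate k (inverse_word w)) \<in> words {1..<n} \<and>
      ev (concat (replicate k (inverse_word w))) = inv (ev w [^] k)" for k
    using w by (induction k) (auto simp: ev_append ev_inverse inverse_word_words inv_mult_group)
  have "ev u [^] (3 :: nat) \<otimes> inv (ev w [^] e) = \<one>"
    using trivial_word_ev[OF rels(4)] words rep[of e] w by (simp add: ev_append numeral_3_eq_3 m_assoc)
  then show "ev u [^] (3 :: nat) = ev w [^] e"
    using words w inv_solve_right'[of \<one> "ev u [^] (3 :: nat)" "ev w [^] e"] by simp
  show "ev w \<noteq> \<one>"
  proof
    assume "ev w = \<one>"
    then have "winding w = winding []" using eval_winding[of w "[]"] w by simp
    then show False using nontrivial by (simp add: winding_acc_eq)
  qed
qed (use words in \<open>simp_all add: w_def inverse_word_words\<close>)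

end

text \<open>In both cases the braids \<open>u\<close> and \<open>v\<close> lift permutations of the nine strands that generate the
  group. Each word is a reduced word of its permutation; the signs of the crossings solve the linear
  system which says that all linking numbers of the relators vanish.\<close>

lemma ex_triple_exponent_3:
  "\<exists>x y z. extraspecial_triple (braid_quotient 9) x y z 0"
proof -
  interpret abelianized_braids "braid_quotient 9" 9 "quotient_gen 9"
    by (rule abelianized_braids_quotient)
  \<comment> \<open>On positions, u acts as (1 2 3)(4 6 8)(5 7 9) and v as (2 4 5)(3 7 6). Thus u
    permutes the blocks {1,8,9}, {2,4,5}, {3,6,7} cyclically, while v fixes the first pointwise and
    rotates the other two.\<close>
  define u :: "nat group_word" where
    "u = [(2, False), (7, False), (8, False), (1, True), (6, False), (7, False), (5, True), (6, True),
      (4, True), (5, True)]"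
  define v :: "nat group_word" where
    "v = [(3, True), (4, True), (5, False), (6, True), (3, False), (4, False), (2, True), (3, False)]"
  have "u \<in> words {1..<9}" "v \<in> words {1..<9}" by (simp_all add: u_def v_def)
  moreover have "trivial_word 9 (commutator_word (commutator_word u v) u)"
    unfolding u_def v_def by code_simp
  moreover have "trivial_word 9 (commutator_word (commutator_word u v) v)"
    unfolding u_def v_def by code_simp
  moreover have "trivial_word 9 (v @ v @ v)" unfolding v_def by code_simp
  moreover have "trivial_word 9 (u @ u @ u @ concat (replicate 0 (inverse_word (commutator_word u v))))"
    unfolding u_def v_def by code_simp
  moreover have "winding_acc (commutator_word u v) 1 2 0 \<noteq> 0"
    unfolding u_def v_def by code_simp
  ultimately show ?thesis using extraspecial_triple_words[of u v _ 1 2] by fastforce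
qed

lemma ex_triple_exponent_9:
  "\<exists>x y z. extraspecial_triple (braid_quotient 9) x y z 1"
proof -
  interpret abelianized_braids "braid_quotient 9" 9 "quotient_gen 9"
    by (rule abelianized_braids_quotient)
  \<comment> \<open>On positions, u is the 9-cycle (1 2 3 4 5 8 9 7 6) and v is (2 5 7)(3 6 8).
    Numbering the positions along this cycle from 0, u adds 1 and v multiplies by 4 modulo
    9.\<close>
  define u :: "nat group_word" where
    "u = [(5, False), (6, True), (8, False), (4, True), (7, True), (3, False), (2, False), (1, True)]"
  define v :: "nat group_word" where
    "v = [(3, False), (6, True), (7, False), (2, True), (5, True), (6, False), (4, True), (5, True),
      (3, False), (4, False), (2, False), (3, True)]"
  have "u \<in> words {1..<9}" "v \<in> words {1..<9}" by (simp_all add: u_def v_def)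
  moreover have "trivial_word 9 (commutator_word (commutator_word u v) u)"
    unfolding u_def v_def by code_simp
  moreover have "trivial_word 9 (commutator_word (commutator_word u v) v)"
    unfolding u_def v_def by code_simp
  moreover have "trivial_word 9 (v @ v @ v)" unfolding v_def by code_simp
  moreover have "trivial_word 9 (u @ u @ u @ concat (replicate 1 (inverse_word (commutator_word u v))))"
    unfolding u_def v_def by code_simp
  moreover have "winding_acc (commutator_word u v) 1 6 0 \<noteq> 0"
    unfolding u_def v_def by code_simp
  ultimately show ?thesis using extraspecial_triple_words[of u v _ 1 6] by fastforce
qed

section \<open>The embeddings\<close>

lemma nonabelian_order_27_embeds:
  assumes "group G" "order G = 27" "\<not> comm_group G"
  shows "embeds_in G (braid_quotient 9)"
proof -
  obtain x y z e where e: "e \<in> {0, 1}" and G: "extraspecial_triple G x y z e"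
    using group.ex_extraspecial_triple[OF assms] by blast
  obtain x' y' z' where Q: "extraspecial_triple (braid_quotient 9) x' y' z' e"
    using e ex_triple_exponent_3 ex_triple_exponent_9 by blast
  show ?thesis
    using embeds_in_triple[OF G Q] extraspecial_triple.range_nf_order_27[OF G assms(2)] by simp
qed

section \<open>The semidirect product of order 27\<close>

lemma group_semidirect_product:
  assumes "group N" "group H" "\<theta> \<in> hom H (AutoGroup N)"
  shows "group (semidirect_product N H \<theta>)"
proof -
  interpret N: group N by fact
  interpret H: group H by fact
  have auto: "\<theta> h \<in> auto N" if "h \<in> carrier H" for h
    using hom_in_carrier[OF assms(3) that] by (simp add: AutoGroup_def)
  have closed: "\<theta> h x \<in> carrier N" if "h \<in> carrier H" "x \<in> carrier N" for h x
    using auto[OF that(1)] that(2) by (auto simp: auto_def hom_def)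
  have mult: "\<theta> h (x \<otimes>\<^bsub>N\<^esub> y) = \<theta> h x \<otimes>\<^bsub>N\<^esub> \<theta> h y"
    if "h \<in> carrier H" "x \<in> carrier N" "y \<in> carrier N" for h x y
    using auto[OF that(1)] that(2,3) by (auto simp: auto_def hom_def)
  have act: "\<theta> (h \<otimes>\<^bsub>H\<^esub> k) x = \<theta> h (\<theta> k x)"
    if "h \<in> carrier H" "k \<in> carrier H" "x \<in> carrier N" for h k x
    using hom_mult[OF assms(3) that(1,2)] auto[OF that(1)] auto[OF that(2)] that(3)
    by (simp add: AutoGroup_def BijGroup_def auto_def compose_eq)
  have one: "\<theta> \<one>\<^bsub>H\<^esub> x = x" if "x \<in> carrier N" for x
    using hom_one[OF assms(3) assms(2) N.AutoGroup] that by (simp add: AutoGroup_def BijGroup_def)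
  show ?thesis
  proof (rule groupI)
    fix a assume "a \<in> carrier (semidirect_product N H \<theta>)"
    then obtain x h where a: "a = (x, h)" "x \<in> carrier N" "h \<in> carrier H"
      by (auto simp: semidirect_product_def)
    let ?k = "inv\<^bsub>H\<^esub> h"
    have "\<theta> ?k (inv\<^bsub>N\<^esub> x) \<otimes>\<^bsub>N\<^esub> \<theta> ?k x = \<theta> ?k \<one>\<^bsub>N\<^esub>"
      using mult[of ?k "inv\<^bsub>N\<^esub> x" x] a by simp
    also have "\<dots> = \<one>\<^bsub>N\<^esub>"
      using mult[of ?k "\<one>\<^bsub>N\<^esub>" "\<one>\<^bsub>N\<^esub>"] closed[of ?k "\<one>\<^bsub>N\<^esub>"] a by (simp add: N.r_cancel_one')
    finally show "\<exists>b \<in> carrier (semidirect_product N H \<theta>). b \<otimes>\<^bsub>semidirect_product N H \<theta>\<^esub> a =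
        \<one>\<^bsub>semidirect_product N H \<theta>\<^esub>"
      using a closed by (intro bexI[of _ "(\<theta> ?k (inv\<^bsub>N\<^esub> x), ?k)"]) (auto simp: semidirect_product_def)
  qed (auto simp: semidirect_product_def closed mult act one N.m_assoc H.m_assoc)
qed

lemma semidirect_product_Z9_Z3_embeds:
  assumes "\<theta> \<in> hom (integer_mod_group 3) (AutoGroup (integer_mod_group 9))"
    and "\<And>x. x \<in> carrier (integer_mod_group 9) \<Longrightarrow> \<theta> 1 x = 4 * x mod 9"
  shows "embeds_in (semidirect_product (integer_mod_group 9) (integer_mod_group 3) \<theta>) (braid_quotient 9)"
    (is "embeds_in ?G _")
proof (rule nonabelian_order_27_embeds)
  show "group ?G" by (intro group_semidirect_product assms(1)) simp_all
  show "order ?G = 27"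
    by (simp add: order_def semidirect_product_def card_cartesian_product carrier_integer_mod_group)
  have zero: "\<theta> 0 0 = 0"
    using hom_one[OF assms(1) _ group.AutoGroup] by (simp add: AutoGroup_def BijGroup_def carrier_integer_mod_group)
  show "\<not> comm_group ?G"
  proof
    assume "comm_group ?G"
    then interpret comm_group ?G .
    \<comment> \<open>The two products are (4, 1) and (1, 1); the second one needs
      \<open>zero\<close>.\<close>
    have "(0, 1) \<otimes>\<^bsub>?G\<^esub> (1, 0) = (1, 0) \<otimes>\<^bsub>?G\<^esub> (0, 1)"
      by (rule m_comm) (auto simp: semidirect_product_def carrier_integer_mod_group)
    then show False using assms(2)[of 1] zero
      by (simp add: semidirect_product_def carrier_integer_mod_group)
  qed
qed

section \<open>The Heisenberg group from its presentation\<close>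

definition heisenberg_class :: "heisenberg_gen \<Rightarrow> heisenberg_gen group_word set" where
  "heisenberg_class g = word_rel UNIV heisenberg_relations `` {[(g, True)]}"

lemma words_UNIV [simp]: "w \<in> words UNIV"
  by (auto simp: words_def)

lemma heisenberg_class_closed: "heisenberg_class g \<in> carrier heisenberg_group_mod_3"
  unfolding heisenberg_class_def heisenberg_group_mod_3_def by (rule class_in_presented_group) simp

lemma eval_word_heisenberg:
  "eval_word heisenberg_group_mod_3 heisenberg_class w = word_rel UNIV heisenberg_relations `` {w}"
  unfolding heisenberg_group_mod_3_def heisenberg_class_def[abs_def]
  by (rule eval_word_presented_group) simp

lemma heisenberg_relation:
  assumes "(u, v) \<in> heisenberg_relations"
  shows "eval_word heisenberg_group_mod_3 heisenberg_class u =
    eval_word heisenberg_group_mod_3 heisenberg_class v"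
  unfolding eval_word_heisenberg
  by (intro equiv_class_eq[OF equiv_word_rel] word_rel.relation assms) simp_all

text \<open>Any group Q with a triple for e = 0 satisfies the defining relations, so evaluation in Q
  would force z = 1 if c were trivial. Taking the braid quotient for Q saves building a separate
  model.\<close>

lemma heisenberg_class_c_neq_one:
  assumes "extraspecial_triple Q x y z 0"
  shows "heisenberg_class c_gen \<noteq> \<one>\<^bsub>heisenberg_group_mod_3\<^esub>"
proof
  interpret Q: extraspecial_triple Q x y z 0 by fact
  let ?f = "case_heisenberg_gen x y z"
  assume "heisenberg_class c_gen = \<one>\<^bsub>heisenberg_group_mod_3\<^esub>"
  then have "([(c_gen, True)], []) \<in> word_rel UNIV heisenberg_relations"
    by (simp add: heisenberg_class_def heisenberg_group_mod_3_def one_presented_group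
        eq_equiv_class_iff[OF equiv_word_rel])
  then have "eval_word Q ?f [(c_gen, True)] = eval_word Q ?f []"
  proof (rule Q.eval_word_rel)
    show "?f ` UNIV \<subseteq> carrier Q" by (auto split: heisenberg_gen.splits)
    fix u v assume "(u, v) \<in> heisenberg_relations"
    moreover have "z = x \<otimes>\<^bsub>Q\<^esub> (y \<otimes>\<^bsub>Q\<^esub> (inv\<^bsub>Q\<^esub> x \<otimes>\<^bsub>Q\<^esub> inv\<^bsub>Q\<^esub> y))"
    proof -
      have "x \<otimes>\<^bsub>Q\<^esub> (y \<otimes>\<^bsub>Q\<^esub> (inv\<^bsub>Q\<^esub> x \<otimes>\<^bsub>Q\<^esub> inv\<^bsub>Q\<^esub> y)) = (x \<otimes>\<^bsub>Q\<^esub> y) \<otimes>\<^bsub>Q\<^esub> inv\<^bsub>Q\<^esub> x \<otimes>\<^bsub>Q\<^esub> inv\<^bsub>Q\<^esub> y"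
        by (simp add: Q.m_assoc)
      also have "\<dots> = z" unfolding Q.xy by (simp add: Q.m_assoc)
      finally show ?thesis by simp
    qed
    moreover have "g \<otimes>\<^bsub>Q\<^esub> (z \<otimes>\<^bsub>Q\<^esub> (inv\<^bsub>Q\<^esub> g \<otimes>\<^bsub>Q\<^esub> inv\<^bsub>Q\<^esub> z)) = \<one>\<^bsub>Q\<^esub>"
      if "g \<in> carrier Q" "z \<otimes>\<^bsub>Q\<^esub> g = g \<otimes>\<^bsub>Q\<^esub> z" for g
    proof -
      have "g \<otimes>\<^bsub>Q\<^esub> (z \<otimes>\<^bsub>Q\<^esub> (inv\<^bsub>Q\<^esub> g \<otimes>\<^bsub>Q\<^esub> inv\<^bsub>Q\<^esub> z)) = (g \<otimes>\<^bsub>Q\<^esub> z) \<otimes>\<^bsub>Q\<^esub> inv\<^bsub>Q\<^esub> g \<otimes>\<^bsub>Q\<^esub> inv\<^bsub>Q\<^esub> z"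
        using that(1) by (simp add: Q.m_assoc)
      then show ?thesis unfolding that(2)[symmetric] using that(1) by (simp add: Q.m_assoc)
    qed
    ultimately show "eval_word Q ?f u = eval_word Q ?f v"
      using Q.y_cube Q.x_cube Q.z_cube Q.zx Q.zy
      by (auto simp: heisenberg_relations_def Let_def numeral_3_eq_3 Q.m_assoc)
  qed
  then show False using Q.z_neq_one by simp
qed

lemma heisenberg_group_triple:
  assumes "extraspecial_triple Q x y z 0"
  shows "extraspecial_triple heisenberg_group_mod_3 (heisenberg_class a_gen) (heisenberg_class b_gen)
    (heisenberg_class c_gen) 0"
proof -
  interpret H: group heisenberg_group_mod_3
    unfolding heisenberg_group_mod_3_def by (rule group_presented_group)
  note [simp] = heisenberg_class_closed
  have commute: "heisenberg_class c_gen \<otimes>\<^bsub>heisenberg_group_mod_3\<^esub> heisenberg_class g =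
      heisenberg_class g \<otimes>\<^bsub>heisenberg_group_mod_3\<^esub> heisenberg_class c_gen"
    if "([(g, True), (c_gen, True), (g, False), (c_gen, False)], []) \<in> heisenberg_relations" for g
    using heisenberg_relation[OF that]
      H.commutator_mult[of "heisenberg_class g" "heisenberg_class c_gen"]
    by (simp add: H.m_assoc)
  have c: "heisenberg_class c_gen = heisenberg_class a_gen \<otimes>\<^bsub>heisenberg_group_mod_3\<^esub>
      (heisenberg_class b_gen \<otimes>\<^bsub>heisenberg_group_mod_3\<^esub>
      (inv\<^bsub>heisenberg_group_mod_3\<^esub> heisenberg_class a_gen \<otimes>\<^bsub>heisenberg_group_mod_3\<^esub>
      inv\<^bsub>heisenberg_group_mod_3\<^esub> heisenberg_class b_gen))"
    using heisenberg_relation[of "[(c_gen, True)]"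
        "[(a_gen, True), (b_gen, True), (a_gen, False), (b_gen, False)]"]
    by (simp add: heisenberg_relations_def Let_def)
  have cube: "heisenberg_class g [^]\<^bsub>heisenberg_group_mod_3\<^esub> (3 :: nat) = \<one>\<^bsub>heisenberg_group_mod_3\<^esub>"
    if "g = a_gen \<or> g = b_gen" for g
    using heisenberg_relation[of "replicate 3 (g, True)" "[]"] that
    by (auto simp: heisenberg_relations_def Let_def numeral_3_eq_3 H.m_assoc)
  show ?thesis
  proof
    show "heisenberg_class a_gen \<otimes>\<^bsub>heisenberg_group_mod_3\<^esub> heisenberg_class b_gen =
      heisenberg_class c_gen \<otimes>\<^bsub>heisenberg_group_mod_3\<^esub> heisenberg_class b_gen
        \<otimes>\<^bsub>heisenberg_group_mod_3\<^esub> heisenberg_class a_gen"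
      unfolding c using H.commutator_mult[of "heisenberg_class a_gen" "heisenberg_class b_gen"]
      by (simp add: H.m_assoc)
    show "heisenberg_class c_gen \<noteq> \<one>\<^bsub>heisenberg_group_mod_3\<^esub>"
      using heisenberg_class_c_neq_one[OF assms] .
  qed (auto intro!: commute cube simp: heisenberg_relations_def Let_def)
qed

text \<open>The order of the presented group is not known here, so the count used for groups of
  order 27 is replaced by an induction over words. Normal forms are closed under products and
  contain each generator together with its inverse, which is its square.\<close>

lemma range_nf_heisenberg:
  assumes "extraspecial_triple heisenberg_group_mod_3 (heisenberg_class a_gen) (heisenberg_class b_gen)
    (heisenberg_class c_gen) 0"
  shows "carrier heisenberg_group_mod_3 \<subseteq> range (extraspecial_triple.nf heisenberg_group_mod_3
    (heisenberg_class a_gen) (heisenberg_class b_gen) (heisenberg_class c_gen))"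
proof -
  interpret H: extraspecial_triple heisenberg_group_mod_3 "heisenberg_class a_gen"
    "heisenberg_class b_gen" "heisenberg_class c_gen" 0 by fact
  have mult: "g \<otimes>\<^bsub>heisenberg_group_mod_3\<^esub> h \<in> range H.nf" if "g \<in> range H.nf" "h \<in> range H.nf" for g h
  proof -
    from that obtain s t where "g = H.nf s" "h = H.nf t" by blast
    then show ?thesis by (cases s; cases t) (simp only: H.nf_mult range_eqI)
  qed
  have inv: "inv\<^bsub>heisenberg_group_mod_3\<^esub> h = h [^]\<^bsub>heisenberg_group_mod_3\<^esub> (2 :: nat)"
    if "h \<in> carrier heisenberg_group_mod_3"
      "h [^]\<^bsub>heisenberg_group_mod_3\<^esub> (3 :: nat) = \<one>\<^bsub>heisenberg_group_mod_3\<^esub>" for h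
    using that by (intro H.inv_equality) (simp_all add: numeral_3_eq_3 numeral_2_eq_2)
  have letter: "(if b then heisenberg_class g else inv\<^bsub>heisenberg_group_mod_3\<^esub> heisenberg_class g)
      \<in> range H.nf" for g b
  proof -
    define k :: nat where "k = (if b then 1 else 2)"
    have "(if b then heisenberg_class g else inv\<^bsub>heisenberg_group_mod_3\<^esub> heisenberg_class g) =
        heisenberg_class g [^]\<^bsub>heisenberg_group_mod_3\<^esub> k"
      using inv H.x_cube H.y_cube H.z_cube heisenberg_class_closed by (cases g) (auto simp: k_def)
    also have "\<dots> = H.nf (case g of a_gen \<Rightarrow> (k, 0, 0) | b_gen \<Rightarrow> (0, k, 0) | c_gen \<Rightarrow> (0, 0, k))"
      using heisenberg_class_closed by (cases g) auto
    finally show ?thesis by (simp only: range_eqI)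
  qed
  have word: "eval_word heisenberg_group_mod_3 heisenberg_class w \<in> range H.nf" for w
  proof (induction w)
    case Nil
    have "\<one>\<^bsub>heisenberg_group_mod_3\<^esub> = H.nf (0, 0, 0)" by simp
    then show ?case unfolding eval_word.simps by (simp only: range_eqI)
  next
    case (Cons p w)
    then show ?case using mult letter by (cases p) (simp only: eval_word.simps)
  qed
  show ?thesis
  proof
    fix A assume "A \<in> carrier heisenberg_group_mod_3"
    then obtain w where "A = word_rel UNIV heisenberg_relations `` {w}"
      unfolding heisenberg_group_mod_3_def by (metis presented_group_cases)
    then show "A \<in> range H.nf" using word by (simp flip: eval_word_heisenberg)
  qed
qed

theorem mainTheorem4:
  shows "(\<forall>G :: 'g monoid. group G \<and> order G = 27 \<and> \<not> comm_group G \<longrightarrow>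
            embeds_in G (braid_quotient 9)) \<and>
         (\<forall>\<theta> \<in> hom (integer_mod_group 3) (AutoGroup (integer_mod_group 9)).
            (\<forall>x \<in> carrier (integer_mod_group 9). \<theta> 1 x = 4 * x mod 9) \<longrightarrow>
            embeds_in (semidirect_product (integer_mod_group 9) (integer_mod_group 3) \<theta>)
              (braid_quotient 9)) \<and>
         embeds_in heisenberg_group_mod_3 (braid_quotient 9)"
proof (intro conjI allI impI ballI)
  obtain x y z where Q: "extraspecial_triple (braid_quotient 9) x y z 0"
    using ex_triple_exponent_3 by blast
  note H = heisenberg_group_triple[OF Q]
  show "embeds_in heisenberg_group_mod_3 (braid_quotient 9)"
    by (rule embeds_in_triple[OF H Q range_nf_heisenberg[OF H]])
qed (use nonabelian_order_27_embeds semidirect_product_Z9_Z3_embeds in blast)+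

end
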